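(* Let $m\ge 1$ be an integer and let $\delta>0$ be real. Consider any of the preferential attachment models (a), (b), (c). For each $t$, let $A_1,A_2$ be two independent uniformly chosen vertices of $[t]$ (independent of the graph), and let $H_t=\mathrm{dist}_{G_{m,\delta}(t)}(A_1,A_2)$ be the graph distance between them in $G_{m,\delta}(t)$. Then, for $c_2=c_2(m,\delta)>0$ sufficiently small, with high probability as $t\to\infty$, $H_t\ge c_2\log t$.
   Context: Preferential attachment models. For an integer $m\ge1$ and a real $\delta\ge -m$, $G_{m,\delta}(t)$ is a random multigraph with vertex set $[t]=\{1,\dots,t\}$ and $mt$ edges. $D_i(t)$ denotes the degree of vertex $i$ at time $t$ (a self-loop adds 2 to the degree). Model (a), $m=1$: $G_{1,\delta}(1)$ is one vertex with one self-loop. Given $G_{1,\delta}(t)$, a vertex $t+1$ with a single edge is added; the other end point of the edge is $t+1$ itself with probability $\frac{1+\delta}{t(2+\delta)+(1+\delta)}$, and is $i\in[t]$ with probability $\frac{D_i(t)+\delta}{t(2+\delta)+(1+\delta)}$. For $m>1$: put $\delta'=\delta/m$, take $G_{1,\delta'}(mt)$, and for each $1\le j\le t$ merge its vertices $(j-1)m+1,\dots,jm$ into the single vertex $j$ of $G_{m,\delta}(t)$ (keeping all edges). Model (b), $m=1$: start from $G_{1,\delta}(2)$, consisting of vertices $1,2$ joined by 2 edges. For $t\ge2$, given $G_{1,\delta}(t)$, vertex $t+1$ with a single edge is added, attached to $i\in[t]$ with probability $\frac{D_i(t)+\delta}{t(2+\delta)}$. For $m>1$, $G_{m,\delta}(t)$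 is obtained from $G_{1,\delta/m}(mt)$ by the same merging as in model (a). Model (c), $m\ge1$: start from $G_{m,\delta}(2)$, consisting of vertices $1,2$ joined by $2m$ edges. For $t\ge2$, given $G_{m,\delta}(t)$, vertex $t+1$ is added with $m$ edges whose other end points are chosen independently, each equal to $i\in[t]$ with probability $\frac{D_i(t)+\delta}{t(2m+\delta)}$. The distance between vertices in different components is $\infty$. A sequence of events $E_t$ occurs with high probability if $\mathbb P(E_t)\to1$ as $t\to\infty$. *)

theory Defs
  imports "HOL-Probability.Probability"
begin

(* A multigraph is the list of its edges in order of creation. Each edge is written as a pair
   (newer end point, older end point), but is read as undirected; (v, v) is a self-loop. The
   vertex set {1..t} is not stored, since every vertex of the models below is incident to an
   edge. *)

type_synonym multigraph = "(nat \<times> nat) list"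

definition vertex_degree :: "multigraph \<Rightarrow> nat \<Rightarrow> nat" where
  "vertex_degree G v = count_list (map fst G) v + count_list (map snd G) v"

definition adj :: "multigraph \<Rightarrow> (nat \<times> nat) set" where
  "adj G = {(u, v). (u, v) \<in> set G \<or> (v, u) \<in> set G}"

(* (u, v) \<in> adj G ^^ n says that there is a walk with n edges from u to v. The infimum of the
   empty set is \<infinity>. *)
definition graph_dist :: "multigraph \<Rightarrow> nat \<Rightarrow> nat \<Rightarrow> enat" where
  "graph_dist G u v = (INF n\<in>{n. (u, v) \<in> adj G ^^ n}. enat n)"

(* In both attachment laws, t is the number of vertices of the current graph G and the value is
   the other end point of an edge of the new vertex t + 1. The lemmas pmf_attach_a and pmf_attach
   below show that embed_pmf is applied to genuine probability mass functions. *)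

definition attach_a :: "real \<Rightarrow> nat \<Rightarrow> multigraph \<Rightarrow> nat pmf" where
  "attach_a \<delta> t G = embed_pmf (\<lambda>i.
     if i = t + 1 then (1 + \<delta>) / (real t * (2 + \<delta>) + (1 + \<delta>))
     else if i \<in> {1..t} then (real (vertex_degree G i) + \<delta>) / (real t * (2 + \<delta>) + (1 + \<delta>))
     else 0)"

definition attach :: "nat \<Rightarrow> real \<Rightarrow> nat \<Rightarrow> multigraph \<Rightarrow> nat pmf" where
  "attach m \<delta> t G = embed_pmf (\<lambda>i.
     if i \<in> {1..t} then (real (vertex_degree G i) + \<delta>) / (real t * (2 * real m + \<delta>)) else 0)"

(* Model (a) starts at time 1, models (b) and (c) start at time 2; the values at earlier times
   are dummies. *)

fun graph_a1 :: "real \<Rightarrow> nat \<Rightarrow> multigraph pmf" where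
  "graph_a1 \<delta> 0 = return_pmf []"
| "graph_a1 \<delta> (Suc 0) = return_pmf [(1, 1)]"
| "graph_a1 \<delta> (Suc (Suc n)) = (let t = Suc n in
     bind_pmf (graph_a1 \<delta> t) (\<lambda>G. map_pmf (\<lambda>i. G @ [(t + 1, i)]) (attach_a \<delta> t G)))"

fun graph_b1 :: "real \<Rightarrow> nat \<Rightarrow> multigraph pmf" where
  "graph_b1 \<delta> 0 = return_pmf []"
| "graph_b1 \<delta> (Suc 0) = return_pmf []"
| "graph_b1 \<delta> (Suc (Suc 0)) = return_pmf [(2, 1), (2, 1)]"
| "graph_b1 \<delta> (Suc (Suc (Suc n))) = (let t = Suc (Suc n) in
     bind_pmf (graph_b1 \<delta> t) (\<lambda>G. map_pmf (\<lambda>i. G @ [(t + 1, i)]) (attach 1 \<delta> t G)))"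

(* replicate_pmf m p is the law of a list of m independent samples of p. *)
fun graph_c :: "nat \<Rightarrow> real \<Rightarrow> nat \<Rightarrow> multigraph pmf" where
  "graph_c m \<delta> 0 = return_pmf []"
| "graph_c m \<delta> (Suc 0) = return_pmf []"
| "graph_c m \<delta> (Suc (Suc 0)) = return_pmf (replicate (2 * m) (2, 1))"
| "graph_c m \<delta> (Suc (Suc (Suc n))) = (let t = Suc (Suc n) in
     bind_pmf (graph_c m \<delta> t) (\<lambda>G.
       map_pmf (\<lambda>xs. G @ map (\<lambda>i. (t + 1, i)) xs) (replicate_pmf m (attach m \<delta> t G))))"

(* Vertices (j - 1) m + 1, ..., j m become j. *)
definition merge_vertices :: "nat \<Rightarrow> multigraph \<Rightarrow> multigraph" where
  "merge_vertices m G = map (map_prod (\<lambda>v. (v - 1) div m + 1) (\<lambda>v. (v - 1) div m + 1)) G"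

datatype pa_model = Model_a | Model_b | Model_c

(* For m = 1 the merging is the identity on edges between positive vertices. *)
fun pa_graph :: "pa_model \<Rightarrow> nat \<Rightarrow> real \<Rightarrow> nat \<Rightarrow> multigraph pmf" where
  "pa_graph Model_a m \<delta> t = map_pmf (merge_vertices m) (graph_a1 (\<delta> / real m) (m * t))"
| "pa_graph Model_b m \<delta> t = map_pmf (merge_vertices m) (graph_b1 (\<delta> / real m) (m * t))"
| "pa_graph Model_c m \<delta> t = graph_c m \<delta> t"

(* The graph together with two independent uniform vertices, for t \<ge> 1. *)
definition pa_sample :: "pa_model \<Rightarrow> nat \<Rightarrow> real \<Rightarrow> nat \<Rightarrow> (multigraph \<times> nat \<times> nat) pmf" where
  "pa_sample M m \<delta> t =
     pair_pmf (pa_graph M m \<delta> t) (pair_pmf (pmf_of_set {1..t}) (pmf_of_set {1..t}))"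

lemma sum_count_list:
  "finite A \<Longrightarrow> set xs \<subseteq> A \<Longrightarrow> (\<Sum>i\<in>A. count_list xs i) = length xs"
proof (induction xs)
  case (Cons x xs)
  have "(\<Sum>i\<in>A. count_list (x # xs) i) = (\<Sum>i\<in>A. count_list xs i + (if x = i then 1 else 0))"
    by (intro sum.cong) auto
  then show ?case using Cons by (simp add: sum.distrib)
qed simp

lemma sum_vertex_degree:
  assumes "set G \<subseteq> {1..t} \<times> {1..t}"
  shows "(\<Sum>i\<in>{1..t}. real (vertex_degree G i)) = 2 * real (length G)"
proof -
  have "set (map fst G) \<subseteq> {1..t}" "set (map snd G) \<subseteq> {1..t}" using assms by auto
  then have "(\<Sum>i\<in>{1..t}. vertex_degree G i) = length (map fst G) + length (map snd G)"
    unfolding vertex_degree_def sum.distrib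
    by (intro arg_cong2[where f = "(+)"] sum_count_list) simp_all
  then show ?thesis unfolding of_nat_sum[symmetric] by simp
qed

lemma pmf_embed_pmf_finite:
  assumes "finite A" "\<And>i. i \<in> A \<Longrightarrow> 0 \<le> f i" "\<And>i. i \<notin> A \<Longrightarrow> f i = 0" "sum f A = 1"
  shows "pmf (embed_pmf f) i = f i"
proof (rule pmf_embed_pmf)
  show "0 \<le> f x" for x using assms(2,3) by (cases "x \<in> A") auto
  have "(\<integral>\<^sup>+x. ennreal (f x) \<partial>count_space UNIV) = (\<Sum>x\<in>A. ennreal (f x))"
    by (rule nn_integral_count_space') (use assms in auto)
  also have "\<dots> = 1" using assms by simp
  finally show "(\<integral>\<^sup>+x. ennreal (f x) \<partial>count_space UNIV) = 1" .
qed

lemma pmf_attach_a: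
  assumes "\<delta> > 0" "set G \<subseteq> {1..t} \<times> {1..t}" "length G = t"
  shows "pmf (attach_a \<delta> t G) i =
    (if i = t + 1 then (1 + \<delta>) / (real t * (2 + \<delta>) + (1 + \<delta>))
     else if i \<in> {1..t} then (real (vertex_degree G i) + \<delta>) / (real t * (2 + \<delta>) + (1 + \<delta>))
     else 0)"
  unfolding attach_a_def
proof (rule pmf_embed_pmf_finite[where A = "{1..t + 1}"])
  let ?D = "real t * (2 + \<delta>) + (1 + \<delta>)"
  let ?f = "\<lambda>i. if i = t + 1 then (1 + \<delta>) / ?D
     else if i \<in> {1..t} then (real (vertex_degree G i) + \<delta>) / ?D else 0"
  have D: "?D > 0" using assms(1) by (simp add: add_nonneg_pos)
  have "sum ?f {1..t + 1} = (1 + \<delta>) / ?D + (\<Sum>i\<in>{1..t}. (real (vertex_degree G i) + \<delta>) / ?D)"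
    by (simp add: atLeastAtMostSuc_conv)
  also have "(\<Sum>i\<in>{1..t}. (real (vertex_degree G i) + \<delta>) / ?D) = real t * (2 + \<delta>) / ?D"
    using sum_vertex_degree[OF assms(2)] assms(3)
    by (simp add: sum_divide_distrib[symmetric] sum.distrib algebra_simps)
  also have "(1 + \<delta>) / ?D + real t * (2 + \<delta>) / ?D = 1"
    using D by (simp add: add_divide_distrib[symmetric] add.commute)
  finally show "sum ?f {1..t + 1} = 1" .
next
  show "0 \<le> (if i = t + 1 then (1 + \<delta>) / (real t * (2 + \<delta>) + (1 + \<delta>))
     else if i \<in> {1..t} then (real (vertex_degree G i) + \<delta>) / (real t * (2 + \<delta>) + (1 + \<delta>))
     else 0)" for i
    using assms(1) by (auto intro!: divide_nonneg_nonneg add_nonneg_nonneg mult_nonneg_nonneg)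
qed auto

lemma pmf_attach:
  assumes "m \<ge> 1" "\<delta> > 0" "t \<ge> 1" "set G \<subseteq> {1..t} \<times> {1..t}" "length G = m * t"
  shows "pmf (attach m \<delta> t G) i =
    (if i \<in> {1..t} then (real (vertex_degree G i) + \<delta>) / (real t * (2 * real m + \<delta>)) else 0)"
  unfolding attach_def
proof (rule pmf_embed_pmf_finite[where A = "{1..t}"])
  let ?D = "real t * (2 * real m + \<delta>)"
  have D: "?D > 0" using assms(2,3) by (simp add: add_nonneg_pos)
  have sum: "(\<Sum>i\<in>{1..t}. real (vertex_degree G i) + \<delta>) = ?D"
    using sum_vertex_degree[OF assms(4)] assms(5) by (simp add: sum.distrib algebra_simps)
  have "(\<Sum>i\<in>{1..t}. if i \<in> {1..t} then (real (vertex_degree G i) + \<delta>) / ?D else 0) =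
      (\<Sum>i\<in>{1..t}. (real (vertex_degree G i) + \<delta>) / ?D)"
    by (rule sum.cong) auto
  also have "\<dots> = ?D / ?D" by (simp only: sum sum_divide_distrib[symmetric])
  also have "\<dots> = 1" using D by (intro divide_self) linarith
  finally show "(\<Sum>i\<in>{1..t}. if i \<in> {1..t} then (real (vertex_degree G i) + \<delta>) / ?D else 0) = 1" .
next
  show "0 \<le> (if i \<in> {1..t} then (real (vertex_degree G i) + \<delta>) / (real t * (2 * real m + \<delta>)) else 0)" for i
    using assms(2) by (auto intro!: divide_nonneg_nonneg add_nonneg_nonneg mult_nonneg_nonneg)
qed auto

lemma graph_a1_wf:
  assumes "\<delta> > 0"
  shows "G \<in> set_pmf (graph_a1 \<delta> t) \<Longrightarrow> set G \<subseteq> {1..t} \<times> {1..t} \<and> length G = t"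
  using assms
proof (induction \<delta> t arbitrary: G rule: graph_a1.induct)
  case (3 \<delta> n)
  let ?t = "Suc n"
  obtain H i where H: "H \<in> set_pmf (graph_a1 \<delta> ?t)" and i: "i \<in> set_pmf (attach_a \<delta> ?t H)"
    and G: "G = H @ [(?t + 1, i)]"
    using 3(2) by (auto simp: Let_def)
  have wf: "set H \<subseteq> {1..?t} \<times> {1..?t}" "length H = ?t" using 3(1)[OF refl H 3(3)] by auto
  have "i \<in> {1..?t + 1}"
    using i by (simp add: set_pmf_iff pmf_attach_a[OF 3(3) wf] split: if_splits)
  moreover have "set H \<subseteq> {1..?t + 1} \<times> {1..?t + 1}" using wf(1) by auto
  ultimately show ?case using wf(2) G by simp
qed auto

lemma graph_b1_wf:
  assumes "\<delta> > 0" "t \<ge> 2"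
  shows "G \<in> set_pmf (graph_b1 \<delta> t) \<Longrightarrow> set G \<subseteq> {1..t} \<times> {1..t} \<and> length G = t"
  using assms
proof (induction \<delta> t arbitrary: G rule: graph_b1.induct)
  case (4 \<delta> n)
  let ?t = "Suc (Suc n)"
  obtain H i where H: "H \<in> set_pmf (graph_b1 \<delta> ?t)" and i: "i \<in> set_pmf (attach 1 \<delta> ?t H)"
    and G: "G = H @ [(?t + 1, i)]"
    using 4(2) by (auto simp: Let_def)
  have wf: "set H \<subseteq> {1..?t} \<times> {1..?t}" "length H = ?t" using 4(1)[OF refl H 4(3)] by auto
  have *: "pmf (attach 1 \<delta> ?t H) i = 0" if "i \<notin> {1..?t}"
    using that by (subst pmf_attach) (use 4(3) wf in simp_all)
  have "i \<in> {1..?t + 1}" using i * by (fastforce simp: set_pmf_iff)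
  moreover have "set H \<subseteq> {1..?t + 1} \<times> {1..?t + 1}" using wf(1) by auto
  ultimately show ?case using wf(2) G by simp
qed auto

lemma graph_c_wf:
  assumes "m \<ge> 1" "\<delta> > 0" "t \<ge> 2"
  shows "G \<in> set_pmf (graph_c m \<delta> t) \<Longrightarrow> set G \<subseteq> {1..t} \<times> {1..t} \<and> length G = m * t"
  using assms
proof (induction m \<delta> t arbitrary: G rule: graph_c.induct)
  case (4 m \<delta> n)
  let ?t = "Suc (Suc n)"
  obtain H xs where H: "H \<in> set_pmf (graph_c m \<delta> ?t)"
    and xs: "set xs \<subseteq> set_pmf (attach m \<delta> ?t H)" "length xs = m"
    and G: "G = H @ map (\<lambda>i. (?t + 1, i)) xs"
    using 4(2) by (auto simp: Let_def set_replicate_pmf)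
  have wf: "set H \<subseteq> {1..?t} \<times> {1..?t}" "length H = m * ?t"
    using 4(1)[OF refl H 4(3,4)] by auto
  have "i \<in> {1..?t}" if "i \<in> set xs" for i
  proof (rule ccontr)
    assume "i \<notin> {1..?t}"
    then have "pmf (attach m \<delta> ?t H) i = 0"
      by (subst pmf_attach) (use 4(3,4) wf in simp_all)
    then show False using that xs(1) by (auto simp: set_pmf_iff)
  qed
  then have "(\<lambda>i. (?t + 1, i)) ` set xs \<subseteq> {1..?t + 1} \<times> {1..?t + 1}" by fastforce
  moreover have "set H \<subseteq> {1..?t + 1} \<times> {1..?t + 1}" using wf(1) by auto
  ultimately show ?case using wf(2) G xs(2) by simp
qed auto

end

theory Submission
  imports Defs "HOL-Real_Asymp.Real_Asymp"
begin

text \<open>The proof is a first moment bound for self-avoiding paths. Fix prescribed targets for some of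
  the edges, each vertex being the target of at most two of them. The product over the vertices of the
  rising factorials of degree plus \<open>\<delta>\<close>, with exponents the numbers of prescriptions still to be
  met, is up to explicit factors a supermartingale on the event that all prescriptions so far are met.
  Hence a self-avoiding path occurs in the graph with probability at most the product over its edges of
  the kernel \<open>\<kappa>(u, v) = C max(u, v)\<^sup>\<gamma>\<^sup>-\<^sup>1 min(u, v)\<^sup>-\<^sup>\<gamma>\<close>, where
  \<open>\<gamma> = m / (2 m + \<delta>)\<close>. As \<open>\<delta> > 0\<close> gives \<open>\<gamma> < 1 / 2\<close>, the kernel maps the
  weight \<open>v\<^sup>-\<^sup>1\<^sup>/\<^sup>2\<close> to at most \<open>L\<close> times itself. So the expected number of
  self-avoiding paths of length \<open>k\<close> is at most \<open>4 L\<^sup>k t\<close>, which for \<open>k \<le> c\<^sub>2 ln t\<close> is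
  negligible compared to the number \<open>t\<^sup>2\<close> of pairs of vertices.\<close>

section \<open>The path kernel\<close>

text \<open>The edges are dependent, because every attachment changes the later laws through the
  degrees. Rising factorials absorb this: hitting a vertex raises its mass by 1, which is the shift
  in their recursion. Regrouping the growth factors by prescribed edge instead of by time, an edge
  from \<open>u\<close> to \<open>v < u\<close> collects about \<open>1 / u\<close> for the hit, and
  the exponential of a harmonic sum from \<open>v\<close> to \<open>u\<close> with weight
  \<open>\<gamma>\<close>, about \<open>(u / v) powr \<gamma>\<close>, for the time during which it
  waits; the product is the kernel. Self-avoidance keeps the cost per edge bounded: \<open>r\<close>
  prescriptions with the same target give a rising factorial with \<open>r\<close> factors, of the
  order of a factorial in \<open>r\<close>, and on a path \<open>r\<close> is at most 2. For
  \<open>m > 1\<close> an edge from \<open>u\<close> to \<open>v\<close> has no fixed position: any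
  of the \<open>m\<close> edges of \<open>u\<close> may serve. Each path event is split over these
  positions, at the price of a factor \<open>m\<close> per edge in \<open>C\<close>. As the models
  differ in what the edges inside such a block see, edges are added one at a time, and the
  attachment law is only bounded above, and only at vertices whose block is complete.\<close>

lemma sum_powr_le:
  assumes "0 < a" "a \<le> 1"
  shows "(\<Sum>v=1..u. real v powr (a - 1)) \<le> 2 / a * real u powr a"
proof (induction u)
  case (Suc u)
  let ?x = "real u + 1"
  \<comment> \<open>Each summand is compared with an increment of \<open>2 / a * x powr a\<close>,
    so that the sum telescopes. The factor 2 over the integral is the price of
    \<open>1 / (1 + y) \<le> 1 - y / 2\<close> on the unit interval.\<close>
  have key: "?x powr (a - 1) \<le> 2 / a * (?x powr a - real u powr a)"
  proof (cases "u = 0")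
    case True
    then show ?thesis using assms by simp
  next
    case False
    define y where "y = a / ?x"
    have y: "0 < y" "y \<le> 1" using assms by (auto simp: y_def field_simps)
    have "ln (real u / ?x) \<le> real u / ?x - 1" using False by (intro ln_le_minus_one) auto
    also have "\<dots> = - (1 / ?x)" by (simp add: field_simps)
    finally have "a * ln (real u / ?x) \<le> a * - (1 / ?x)"
      using assms(1) by (intro mult_left_mono) auto
    then have "a * ln (real u / ?x) \<le> - y" by (simp add: y_def)
    then have "(real u / ?x) powr a \<le> exp (- y)" using False by (simp add: powr_def)
    also have "\<dots> \<le> 1 / (1 + y)"
      using exp_ge_add_one_self[of y] y by (simp add: exp_minus field_simps)
    also have "\<dots> \<le> 1 - y / 2"
      using y mult_left_mono[of y 1 y] by (simp add: field_simps)
    finally have "?x powr a * (real u / ?x) powr a \<le> ?x powr a * (1 - y / 2)"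
      by (intro mult_left_mono) auto
    then have "real u powr a \<le> ?x powr a * (1 - y / 2)" by (simp add: powr_divide)
    then have "?x powr a * (y / 2) \<le> ?x powr a - real u powr a" by (simp add: algebra_simps)
    then have "2 / a * (?x powr a * (y / 2)) \<le> 2 / a * (?x powr a - real u powr a)"
      using assms(1) by (intro mult_left_mono) auto
    moreover have "2 / a * (?x powr a * (y / 2)) = ?x powr (a - 1)"
      using assms(1) by (simp add: y_def powr_diff divide_simps)
    ultimately show ?thesis by simp
  qed
  have "(\<Sum>v=1..Suc u. real v powr (a - 1)) = (\<Sum>v=1..u. real v powr (a - 1)) + ?x powr (a - 1)"
    by (simp add: add.commute)
  also have "\<dots> \<le> 2 / a * real u powr a + 2 / a * (?x powr a - real u powr a)"
    using Suc key by linarith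
  finally show ?case by (simp add: algebra_simps)
qed simp

lemma sum_powr_tail_le:
  assumes "0 < a" "1 \<le> u"
  shows "(\<Sum>v=Suc u..t. real v powr (- a - 1)) \<le> 1 / a * real u powr (- a)"
proof (cases "u \<le> t")
  case True
  \<comment> \<open>The subtracted boundary term makes the induction go through: it is the integral
    over a finite range, and each step is a telescoping difference.\<close>
  have "(\<Sum>v=Suc u..t. real v powr (- a - 1)) \<le> 1 / a * (real u powr (- a) - real t powr (- a))"
    using True
  proof (induction t rule: dec_induct)
    case (step t)
    let ?x = "real t + 1"
    have t: "t > 0" using step assms by simp
    have "ln (real t / ?x) \<le> real t / ?x - 1" using t by (intro ln_le_minus_one) auto
    also have "\<dots> = - (1 / ?x)" by (simp add: field_simps)
    finally have "a * ln (real t / ?x) \<le> a * - (1 / ?x)"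
      using assms(1) by (intro mult_left_mono) auto
    then have "a / ?x \<le> - a * ln (real t / ?x)" by simp
    then have "1 + a / ?x \<le> (real t / ?x) powr (- a)"
      using exp_ge_add_one_self[of "- a * ln (real t / ?x)"] t by (simp add: powr_def)
    then have "?x powr (- a) * (1 + a / ?x) \<le> ?x powr (- a) * (real t / ?x) powr (- a)"
      by (intro mult_left_mono) auto
    then have "?x powr (- a) * (1 + a / ?x) \<le> real t powr (- a)" by (simp add: powr_divide)
    then have "1 / a * (?x powr (- a) * (a / ?x)) \<le> 1 / a * (real t powr (- a) - ?x powr (- a))"
      using assms(1) by (intro mult_left_mono) (auto simp: algebra_simps)
    moreover have "1 / a * (?x powr (- a) * (a / ?x)) = ?x powr (- a - 1)"
      using assms(1) by (simp add: powr_diff)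
    ultimately have "?x powr (- a - 1) \<le> 1 / a * (real t powr (- a) - ?x powr (- a))" by simp
    moreover have "(\<Sum>v=Suc u..Suc t. real v powr (- a - 1)) =
        (\<Sum>v=Suc u..t. real v powr (- a - 1)) + ?x powr (- a - 1)"
      using step by (simp add: add.commute)
    ultimately show ?case using step.IH by (simp add: algebra_simps)
  qed simp
  also have "\<dots> \<le> 1 / a * real u powr (- a)" using assms by (intro mult_left_mono) auto
  finally show ?thesis .
next
  case False
  then show ?thesis using assms by simp
qed

definition pa_kernel :: "real \<Rightarrow> real \<Rightarrow> nat \<Rightarrow> nat \<Rightarrow> real" where
  "pa_kernel C \<gamma> u v = C * real (max u v) powr (\<gamma> - 1) * real (min u v) powr (- \<gamma>)"

text \<open>With \<open>a = 1 / 2 - \<gamma>\<close>, the summand has exponent \<open>a - 1\<close>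
  in \<open>v\<close> below \<open>u\<close> and \<open>- a - 1\<close> above \<open>u\<close>. As
  \<open>a > 0\<close>, both sums are dominated by \<open>v\<close> near \<open>u\<close> and are of
  order \<open>u powr (- 1 / 2)\<close>. The constant 3 is 2 from below plus 1 from above.\<close>

lemma sum_pa_kernel_le:
  assumes "0 \<le> C" "0 \<le> \<gamma>" "\<gamma> < 1 / 2" "u \<in> {1..t}"
  shows "(\<Sum>v=1..t. pa_kernel C \<gamma> u v * real v powr (- 1 / 2))
    \<le> 3 * C / (1 / 2 - \<gamma>) * real u powr (- 1 / 2)"
proof -
  define a where "a = 1 / 2 - \<gamma>"
  have a: "0 < a" "a \<le> 1" using assms by (auto simp: a_def)
  let ?f = "\<lambda>v. pa_kernel C \<gamma> u v * real v powr (- 1 / 2)"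
  have "(\<Sum>v=1..u. ?f v) = (\<Sum>v=1..u. C * real u powr (\<gamma> - 1) * real v powr (a - 1))"
  proof (intro sum.cong refl)
    fix v assume "v \<in> {1..u}"
    then have "max u v = u" "min u v = v" by auto
    moreover have "real v powr (- \<gamma>) * real v powr (- 1 / 2) = real v powr (a - 1)"
      unfolding powr_add[symmetric] a_def by (rule arg_cong[where f = "\<lambda>y. real v powr y"]) simp
    ultimately show "?f v = C * real u powr (\<gamma> - 1) * real v powr (a - 1)"
      by (simp add: pa_kernel_def)
  qed
  also have "\<dots> = C * real u powr (\<gamma> - 1) * (\<Sum>v=1..u. real v powr (a - 1))"
    by (simp add: sum_distrib_left)
  also have "\<dots> \<le> C * real u powr (\<gamma> - 1) * (2 / a * real u powr a)"
    using assms(1) by (intro mult_left_mono sum_powr_le a) auto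
  also have "\<dots> = 2 * C / a * real u powr (- 1 / 2)"
    by (simp add: a_def powr_add[symmetric])
  finally have 1: "(\<Sum>v=1..u. ?f v) \<le> 2 * C / a * real u powr (- 1 / 2)" .
  have "(\<Sum>v=Suc u..t. ?f v) = (\<Sum>v=Suc u..t. C * real u powr (- \<gamma>) * real v powr (- a - 1))"
  proof (intro sum.cong refl)
    fix v assume "v \<in> {Suc u..t}"
    then have "max u v = v" "min u v = u" by auto
    moreover have "real v powr (\<gamma> - 1) * real v powr (- 1 / 2) = real v powr (- a - 1)"
      by (simp add: a_def flip: powr_add)
    ultimately show "?f v = C * real u powr (- \<gamma>) * real v powr (- a - 1)"
      by (simp add: pa_kernel_def mult_ac)
  qed
  also have "\<dots> = C * real u powr (- \<gamma>) * (\<Sum>v=Suc u..t. real v powr (- a - 1))"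
    by (simp add: sum_distrib_left)
  also have "\<dots> \<le> C * real u powr (- \<gamma>) * (1 / a * real u powr (- a))"
    using assms by (intro mult_left_mono sum_powr_tail_le a) auto
  also have "\<dots> = C / a * real u powr (- 1 / 2)"
    by (simp add: a_def powr_add[symmetric])
  finally have 2: "(\<Sum>v=Suc u..t. ?f v) \<le> C / a * real u powr (- 1 / 2)" .
  have "(\<Sum>v=1..t. ?f v) = (\<Sum>v=1..u. ?f v) + (\<Sum>v=Suc u..t. ?f v)"
    using assms(4) sum.ub_add_nat[of 1 u ?f "t - u"] by simp
  also have "\<dots> \<le> 2 * C / a * real u powr (- 1 / 2) + C / a * real u powr (- 1 / 2)"
    using 1 2 by linarith
  also have "\<dots> = 3 * C / a * real u powr (- 1 / 2)"
    using a by (simp add: field_simps)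
  finally show ?thesis by (simp add: a_def)
qed

section \<open>Sums over vertex sequences\<close>

definition path_weight :: "(nat \<Rightarrow> nat \<Rightarrow> real) \<Rightarrow> nat list \<Rightarrow> real" where
  "path_weight \<kappa> xs = (\<Prod>i<length xs - 1. \<kappa> (xs ! i) (xs ! Suc i))"

lemma path_weight_Cons:
  assumes "xs \<noteq> []"
  shows "path_weight \<kappa> (x # xs) = \<kappa> x (hd xs) * path_weight \<kappa> xs"
proof (cases xs)
  case (Cons y ys)
  then show ?thesis by (simp add: path_weight_def prod.lessThan_Suc_shift del: prod.lessThan_Suc)
qed (use assms in simp)

definition vertex_seqs :: "nat \<Rightarrow> nat \<Rightarrow> nat \<Rightarrow> nat list set" where
  "vertex_seqs t k x = {xs. set xs \<subseteq> {1..t} \<and> length xs = Suc k \<and> hd xs = x}"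

lemma finite_vertex_seqs: "finite (vertex_seqs t k x)"
  by (rule finite_subset[OF _ finite_lists_length_eq[of "{1..t}" "Suc k"]])
    (auto simp: vertex_seqs_def)

lemma vertex_seqs_0: "x \<in> {1..t} \<Longrightarrow> vertex_seqs t 0 x = {[x]}"
  by (auto simp: vertex_seqs_def length_Suc_conv)

lemma vertex_seqs_Suc:
  assumes "x \<in> {1..t}"
  shows "vertex_seqs t (Suc k) x = (#) x ` (\<Union>y\<in>{1..t}. vertex_seqs t k y)"
proof -
  have "xs \<in> (#) x ` (\<Union>y\<in>{1..t}. vertex_seqs t k y)" if "xs \<in> vertex_seqs t (Suc k) x" for xs
  proof -
    have "length xs = Suc (Suc k)" using that by (simp add: vertex_seqs_def)
    then obtain y ys where xs: "xs = y # ys" "length ys = Suc k" by (cases xs) auto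
    moreover obtain z zs where "ys = z # zs" using xs(2) by (cases ys) auto
    ultimately have "xs = x # z # zs" using that by (simp add: vertex_seqs_def)
    then show ?thesis using that by (auto simp: vertex_seqs_def)
  qed
  then show ?thesis using assms by (auto simp: vertex_seqs_def)
qed

text \<open>Splitting off the first vertex turns the sum into \<open>k\<close> applications of the
  kernel, each of which costs a factor \<open>L\<close> on the weight \<open>h\<close>.\<close>

lemma sum_path_weight_le:
  assumes \<kappa>: "\<And>u v. 0 \<le> \<kappa> u v"
    and L: "\<And>u. u \<in> {1..t} \<Longrightarrow> (\<Sum>v=1..t. \<kappa> u v * h v) \<le> L * h u"
    and "x \<in> {1..t}" "0 \<le> L"
  shows "(\<Sum>xs\<in>vertex_seqs t k x. path_weight \<kappa> xs * h (last xs)) \<le> L ^ k * h x"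
  using assms(3)
proof (induction k arbitrary: x)
  case 0
  then show ?case by (simp add: vertex_seqs_0 path_weight_def)
next
  case (Suc k)
  have ne: "xs \<noteq> []" "hd xs = y" if "xs \<in> vertex_seqs t k y" for xs y
    using that by (auto simp: vertex_seqs_def)
  have "(\<Sum>xs\<in>vertex_seqs t (Suc k) x. path_weight \<kappa> xs * h (last xs)) =
      (\<Sum>xs\<in>(\<Union>y\<in>{1..t}. vertex_seqs t k y). path_weight \<kappa> (x # xs) * h (last (x # xs)))"
    unfolding vertex_seqs_Suc[OF Suc.prems] by (subst sum.reindex) (auto simp: inj_on_def)
  also have "\<dots> = (\<Sum>y\<in>{1..t}. \<Sum>xs\<in>vertex_seqs t k y. path_weight \<kappa> (x # xs) * h (last (x # xs)))"
    by (intro sum.UNION_disjoint ballI finite_vertex_seqs) (auto simp: vertex_seqs_def)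
  also have "\<dots> = (\<Sum>y\<in>{1..t}. \<kappa> x y * (\<Sum>xs\<in>vertex_seqs t k y. path_weight \<kappa> xs * h (last xs)))"
    unfolding sum_distrib_left
    by (intro sum.cong refl) (auto simp: path_weight_Cons ne)
  also have "\<dots> \<le> (\<Sum>y\<in>{1..t}. \<kappa> x y * (L ^ k * h y))"
    by (intro sum_mono mult_left_mono Suc.IH \<kappa>) auto
  also have "\<dots> = L ^ k * (\<Sum>y=1..t. \<kappa> x y * h y)"
    by (simp add: sum_distrib_left mult_ac)
  also have "\<dots> \<le> L ^ k * (L * h x)"
    using assms(4) by (intro mult_left_mono L Suc.prems) auto
  finally show ?case by (simp add: mult_ac)
qed

text \<open>The weight at the last vertex is at least \<open>t powr (- 1 / 2)\<close>, so inserting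
  it costs \<open>t powr (1 / 2)\<close>. Summing the weight of the first vertex gives at most
  \<open>4 * t powr (1 / 2)\<close>; hence the factor 4 and the linear growth in
  \<open>t\<close>.\<close>

lemma sum_path_weight_pa_kernel_le:
  assumes "0 \<le> C" "0 \<le> \<gamma>" "\<gamma> < 1 / 2"
  shows "(\<Sum>x=1..t. \<Sum>xs\<in>vertex_seqs t k x. path_weight (pa_kernel C \<gamma>) xs)
    \<le> 4 * (3 * C / (1 / 2 - \<gamma>)) ^ k * real t"
proof -
  let ?L = "3 * C / (1 / 2 - \<gamma>)" and ?w = "path_weight (pa_kernel C \<gamma>)"
  let ?h = "\<lambda>v. real v powr (- 1 / 2)"
  have \<kappa>: "0 \<le> pa_kernel C \<gamma> u v" for u v using assms by (simp add: pa_kernel_def)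
  have L: "0 \<le> ?L" using assms by simp
  have inner: "(\<Sum>xs\<in>vertex_seqs t k x. ?w xs) \<le> real t powr (1 / 2) * (?L ^ k * ?h x)"
    if x: "x \<in> {1..t}" for x
  proof -
    have "?w xs \<le> real t powr (1 / 2) * (?w xs * ?h (last xs))"
      if xs: "xs \<in> vertex_seqs t k x" for xs
    proof -
      have "last xs \<in> {1..t}" using xs last_in_set[of xs] unfolding vertex_seqs_def by fastforce
      then have "real t powr (- 1 / 2) \<le> ?h (last xs)"
        by (intro powr_mono2') auto
      then have "real t powr (1 / 2) * real t powr (- 1 / 2) \<le> real t powr (1 / 2) * ?h (last xs)"
        by (intro mult_left_mono) auto
      then have "1 \<le> real t powr (1 / 2) * ?h (last xs)" using x by (simp add: powr_add[symmetric])
      moreover have "0 \<le> ?w xs" unfolding path_weight_def by (intro prod_nonneg \<kappa>)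
      ultimately show ?thesis
        using mult_left_mono[of 1 "real t powr (1 / 2) * ?h (last xs)" "?w xs"]
        by (simp add: mult_ac)
    qed
    then have "(\<Sum>xs\<in>vertex_seqs t k x. ?w xs)
        \<le> (\<Sum>xs\<in>vertex_seqs t k x. real t powr (1 / 2) * (?w xs * ?h (last xs)))"
      by (intro sum_mono)
    also have "\<dots> = real t powr (1 / 2) * (\<Sum>xs\<in>vertex_seqs t k x. ?w xs * ?h (last xs))"
      by (simp add: sum_distrib_left)
    also have "\<dots> \<le> real t powr (1 / 2) * (?L ^ k * ?h x)"
      using sum_pa_kernel_le[OF assms]
      by (intro mult_left_mono sum_path_weight_le \<kappa> x L) auto
    finally show ?thesis .
  qed
  have "(\<Sum>x=1..t. \<Sum>xs\<in>vertex_seqs t k x. ?w xs)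
      \<le> (\<Sum>x=1..t. real t powr (1 / 2) * (?L ^ k * ?h x))"
    by (intro sum_mono inner) auto
  also have "\<dots> = real t powr (1 / 2) * ?L ^ k * (\<Sum>x=1..t. real x powr (1 / 2 - 1))"
    by (simp add: sum_distrib_left sum_distrib_right mult_ac)
  also have "\<dots> \<le> real t powr (1 / 2) * ?L ^ k * (2 / (1 / 2) * real t powr (1 / 2))"
    using L by (intro mult_left_mono sum_powr_le) auto
  also have "\<dots> = 4 * ?L ^ k * (real t powr (1 / 2) * real t powr (1 / 2))" by simp
  also have "real t powr (1 / 2) * real t powr (1 / 2) = real t"
    by (simp add: powr_add[symmetric])
  finally show ?thesis .
qed

section \<open>Relabelled multigraphs\<close>

abbreviation relabel :: "(nat \<Rightarrow> nat) \<Rightarrow> multigraph \<Rightarrow> multigraph" where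
  "relabel \<phi> G \<equiv> map (map_prod \<phi> \<phi>) G"

lemma vertex_degree_append:
  "vertex_degree (G @ H) v = vertex_degree G v + vertex_degree H v"
  by (simp add: vertex_degree_def)

lemma vertex_degree_single:
  "vertex_degree [(u, v)] w = of_bool (u = w) + of_bool (v = w)"
  by (simp add: vertex_degree_def)

lemma vertex_degree_le: "vertex_degree G v \<le> 2 * length G"
  using count_le_length[of "map fst G" v] count_le_length[of "map snd G" v]
  by (simp add: vertex_degree_def)

lemma vertex_degree_eq_0:
  assumes "\<And>e. e < length G \<Longrightarrow> fst (G ! e) \<noteq> v \<and> snd (G ! e) \<noteq> v"
  shows "vertex_degree G v = 0"
proof -
  have "v \<notin> set (map fst G)" "v \<notin> set (map snd G)"
    using assms by (force simp: in_set_conv_nth)+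
  then show ?thesis unfolding vertex_degree_def by (simp add: count_list_0_iff)
qed

lemma sum_count_list_le_count_list_map:
  assumes "finite A" "\<And>i. i \<in> A \<Longrightarrow> f i = u"
  shows "(\<Sum>i\<in>A. count_list xs i) \<le> count_list (map f xs) u"
proof (induction xs)
  case (Cons x xs)
  have "(\<Sum>i\<in>A. count_list (x # xs) i) = (\<Sum>i\<in>A. count_list xs i + (if x = i then 1 else 0))"
    by (intro sum.cong) auto
  also have "\<dots> = (\<Sum>i\<in>A. count_list xs i) + (if x \<in> A then 1 else 0)"
    using assms(1) by (simp add: sum.distrib)
  finally show ?case using Cons assms(2)[of x] by auto
qed simp

lemma sum_vertex_degree_le_relabel:
  assumes "finite A" "\<And>i. i \<in> A \<Longrightarrow> \<phi> i = u"
  shows "(\<Sum>i\<in>A. vertex_degree G i) \<le> vertex_degree (relabel \<phi> G) u"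
  using sum_count_list_le_count_list_map[where f = \<phi> and xs = "map fst G", OF assms]
    sum_count_list_le_count_list_map[where f = \<phi> and xs = "map snd G", OF assms]
  by (simp add: vertex_degree_def sum.distrib comp_def add_mono)

lemma pochhammer_mono:
  assumes "0 < x" "x \<le> (y :: real)"
  shows "pochhammer x n \<le> pochhammer y n"
  unfolding pochhammer_prod using assms by (intro prod_mono) auto

text \<open>Multiplied by \<open>x\<close>, both sides are \<open>pochhammer x (n + 1)\<close>, with
  a factor split off at the front or at the back.\<close>

lemma pochhammer_add_one:
  assumes "0 < (x :: real)"
  shows "pochhammer (x + 1) n = pochhammer x n * (1 + real n / x)"
proof -
  have "x * pochhammer (x + 1) n = (x + real n) * pochhammer x n"
    using pochhammer_rec[of x n] pochhammer_rec'[of x n] by simp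
  then show ?thesis using assms by (simp add: field_simps)
qed

text \<open>The integrand is the shape of the relative change of \<open>potential\<close> in one
  step, where at most one vertex is hit.\<close>

lemma nn_integral_pmf_point_weights:
  assumes "finite V" "\<And>w. w \<in> V \<Longrightarrow> 0 \<le> b w"
  shows "(\<integral>\<^sup>+u. ennreal (1 + (\<Sum>w\<in>V. of_bool (u = w) * b w)) \<partial>measure_pmf Q) =
    ennreal (1 + (\<Sum>w\<in>V. pmf Q w * b w))"
proof -
  have "ennreal (1 + (\<Sum>w\<in>V. of_bool (u = w) * b w)) =
      1 + (\<Sum>w\<in>V. ennreal (b w) * indicator {w} u)" for u
  proof -
    have "ennreal (1 + (\<Sum>w\<in>V. of_bool (u = w) * b w)) =
        1 + (\<Sum>w\<in>V. ennreal (of_bool (u = w) * b w))"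
      using assms by (subst ennreal_plus) (auto intro!: sum_nonneg simp: sum_ennreal)
    also have "(\<Sum>w\<in>V. ennreal (of_bool (u = w) * b w)) = (\<Sum>w\<in>V. ennreal (b w) * indicator {w} u)"
      by (intro sum.cong refl) (auto simp: indicator_def)
    finally show ?thesis .
  qed
  then have "(\<integral>\<^sup>+u. ennreal (1 + (\<Sum>w\<in>V. of_bool (u = w) * b w)) \<partial>measure_pmf Q) =
      1 + (\<Sum>w\<in>V. ennreal (b w) * ennreal (pmf Q w))"
    by (simp add: nn_integral_add nn_integral_sum nn_integral_cmult_indicator emeasure_pmf_single)
  also have "\<dots> = 1 + (\<Sum>w\<in>V. ennreal (pmf Q w * b w))"
    using assms(2) by (simp add: ennreal_mult mult.commute)
  also have "\<dots> = ennreal (1 + (\<Sum>w\<in>V. pmf Q w * b w))"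
    using assms by (subst ennreal_plus) (auto intro!: sum_nonneg simp: sum_ennreal)
  finally show ?thesis .
qed

section \<open>Attachment chains\<close>

text \<open>Edges are numbered from 0 in order of creation. Edge \<open>n \<ge> 2 * m\<close> is the \<open>n\<close>-th edge of the
  chain and comes from vertex \<open>n div m + 1\<close>; the first \<open>2 * m\<close> edges only involve vertices 1
  and 2, in a way that depends on the model. The map \<open>\<phi>\<close> is the merging of vertices, and \<open>c n\<close> is the label of
  the newer end point before merging. The bound on the attachment law refers to the current degrees,
  which for model (c) exceed the degrees that the model uses.\<close>

locale pa_chain =
  fixes m :: nat and \<delta> :: real and \<phi> :: "nat \<Rightarrow> nat" and c :: "nat \<Rightarrow> nat"
    and K :: "nat \<Rightarrow> multigraph \<Rightarrow> nat pmf" and \<mu> :: "nat \<Rightarrow> multigraph pmf"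
  assumes m: "m \<ge> 1" and \<delta>: "\<delta> > 0"
    and step: "\<And>n. 2 * m \<le> n \<Longrightarrow>
      \<mu> (Suc n) = bind_pmf (\<mu> n) (\<lambda>H. map_pmf (\<lambda>i. H @ [(c n, i)]) (K n H))"
    and label: "\<And>n. \<phi> (c n) = n div m + 1"
    and init: "\<And>H. H \<in> set_pmf (\<mu> (2 * m)) \<Longrightarrow>
      length H = 2 * m \<and> set (relabel \<phi> H) \<subseteq> {1..2} \<times> {1..2}"
    and support: "\<And>n H i. 2 * m \<le> n \<Longrightarrow> H \<in> set_pmf (\<mu> n) \<Longrightarrow> i \<in> set_pmf (K n H) \<Longrightarrow>
      \<phi> i \<in> {1..n div m + 1}"
    and attachment: "\<And>n H u. 2 * m \<le> n \<Longrightarrow> H \<in> set_pmf (\<mu> n) \<Longrightarrow> u \<le> n div m \<Longrightarrow>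
      pmf (map_pmf \<phi> (K n H)) u
        \<le> (real (vertex_degree (relabel \<phi> H) u) + \<delta>) / (real (n div m) * (2 * real m + \<delta>))"
begin

text \<open>This normalising constant stays fixed while one vertex sends its \<open>m\<close> edges.
  It is exact in model (c) and a lower bound for the actual constant in models (a) and (b), where
  the constant changes with every edge.\<close>

definition norm_at :: "nat \<Rightarrow> real" where
  "norm_at n = real (n div m) * (2 * real m + \<delta>)"

lemma div_ge_2: "2 * m \<le> n \<Longrightarrow> 2 \<le> n div m"
  using m by (simp add: less_eq_div_iff_mult_less_eq)

lemma norm_at_pos: "2 * m \<le> n \<Longrightarrow> 0 < norm_at n"
  using div_ge_2[of n] \<delta> by (simp add: norm_at_def add_nonneg_pos)

lemma wf:
  assumes "2 * m \<le> n" "H \<in> set_pmf (\<mu> n)"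
  shows "length H = n \<and> (\<forall>e<n. relabel \<phi> H ! e \<in>
    (if e < 2 * m then {1..2} \<times> {1..2} else {e div m + 1} \<times> {1..e div m + 1}))"
  using assms
proof (induction n arbitrary: H rule: dec_induct)
  case base
  then have "length H = 2 * m" "set (relabel \<phi> H) \<subseteq> {1..2} \<times> {1..2}" using init by auto
  moreover have "relabel \<phi> H ! e \<in> set (relabel \<phi> H)" if "e < 2 * m" for e
    using that \<open>length H = 2 * m\<close> by (intro nth_mem) simp
  ultimately show ?case by auto
next
  case (step n)
  obtain G i where G: "G \<in> set_pmf (\<mu> n)" and i: "i \<in> set_pmf (K n G)" and H: "H = G @ [(c n, i)]"
    using step.prems pa_chain.step[OF pa_chain_axioms step.hyps(1)] by auto
  have "\<phi> i \<in> {1..n div m + 1}" by (rule support[OF step.hyps(1) G i])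
  then have new: "(\<phi> (c n), \<phi> i) \<in> {n div m + 1} \<times> {1..n div m + 1}" by (simp add: label)
  have len: "length G = n" using step.IH[OF G] by simp
  show ?case
  proof (intro conjI allI impI)
    fix e assume "e < Suc n"
    then consider "e < n" | "e = n" by linarith
    then show "relabel \<phi> H ! e \<in>
        (if e < 2 * m then {1..2} \<times> {1..2} else {e div m + 1} \<times> {1..e div m + 1})"
    proof cases
      case 1
      then show ?thesis using step.IH[OF G] len unfolding H by (simp only: nth_append map_append) simp
    next
      case 2
      then show ?thesis using new step.hyps len by (simp add: H nth_append)
    qed
  qed (simp add: H len)
qed

section \<open>The supermartingale for prescribed targets\<close>

context
  fixes S :: "nat set" and \<tau> :: "nat \<Rightarrow> nat"
  assumes S: "finite S" and \<tau>: "\<And>e. e \<in> S \<Longrightarrow> 2 * m \<le> e \<and> \<tau> e \<le> e div m"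
begin

definition pending :: "nat \<Rightarrow> nat \<Rightarrow> nat" where
  "pending n w = card {e \<in> S. n \<le> e \<and> \<tau> e = w}"

text \<open>Before the block of edges of \<open>w\<close> is complete, the upper bound \<open>4 * m\<close> for the degree of \<open>w\<close>
  at its completion takes the place of the degree.\<close>

definition mass :: "nat \<Rightarrow> multigraph \<Rightarrow> nat \<Rightarrow> real" where
  "mass n G w = (if w \<le> n div m then real (vertex_degree G w) + \<delta> else 4 * real m + \<delta>)"

text \<open>Rising factorials turn into eigenfunctions of the attachment step: if \<open>x\<close> becomes \<open>x + 1\<close> with
  probability \<open>x / W\<close>, the mean of \<open>pochhammer x r\<close> is multiplied by \<open>1 + r / W\<close>.\<close>

definition potential :: "nat \<Rightarrow> multigraph \<Rightarrow> real" where
  "potential n G = (\<Prod>w\<in>\<tau> ` S. pochhammer (mass n G w) (pending n w))"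

definition hits :: "nat \<Rightarrow> multigraph \<Rightarrow> bool" where
  "hits n G \<longleftrightarrow> (\<forall>e\<in>S. e < n \<longrightarrow> snd (G ! e) = \<tau> e)"

text \<open>The first factor pays for meeting a prescription at edge \<open>n\<close>. The product
  bounds \<open>1 + r / norm_at n\<close>, with \<open>r\<close> the number of later prescriptions
  whose target is already complete, by an exponential that splits over these prescriptions. This is
  what later allows the products over time and over prescriptions to be exchanged.\<close>

definition growth :: "nat \<Rightarrow> real" where
  "growth n = (if n \<in> S then 1 / norm_at n else 1) *
    (\<Prod>e\<in>S. if n < e \<and> \<tau> e \<le> n div m then exp (1 / norm_at n) else 1)"

lemma mass_pos: "0 < mass n G w"
  using \<delta> by (simp add: mass_def add_nonneg_pos)

lemma growth_nonneg: "2 * m \<le> n \<Longrightarrow> 0 \<le> growth n"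
  using norm_at_pos[of n] unfolding growth_def by (intro mult_nonneg_nonneg prod_nonneg) auto

lemma potential_pos: "0 < potential n G"
  unfolding potential_def by (intro prod_pos pochhammer_pos ballI mass_pos)

text \<open>The critical case is the edge that completes the block of \<open>w\<close>: its actual
  degree then replaces the cap. Earlier blocks cannot touch \<open>w\<close>, and the
  \<open>m\<close> edges of its own block add at most 2 each, so the cap is not exceeded.\<close>

lemma mass_Suc_le:
  assumes n: "2 * m \<le> n" and H: "H \<in> set_pmf (\<mu> n)" and i: "i \<in> set_pmf (K n H)"
  shows "mass (Suc n) (relabel \<phi> (H @ [(c n, i)])) w
    \<le> mass n (relabel \<phi> H) w + of_bool (\<phi> i = w \<and> w \<le> n div m)"
proof -
  let ?G = "relabel \<phi> H" and ?G' = "relabel \<phi> (H @ [(c n, i)])"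
  have deg: "vertex_degree ?G' w = vertex_degree ?G w + of_bool (n div m + 1 = w) + of_bool (\<phi> i = w)"
    by (simp add: vertex_degree_append vertex_degree_single label)
  have le: "n div m \<le> Suc n div m" by (simp add: div_le_mono)
  consider "w \<le> n div m" | "\<not> w \<le> Suc n div m" | "\<not> w \<le> n div m" "w \<le> Suc n div m" by blast
  then show ?thesis
  proof cases
    case 1
    then have "w \<le> Suc n div m" using le by linarith
    then show ?thesis using 1 deg unfolding mass_def by simp
  next
    case 2
    then have "\<not> w \<le> n div m" using le by linarith
    then show ?thesis using 2 by (simp add: mass_def)
  next
    case 3
    have "Suc n div m \<le> Suc (n div m)" using m by (simp add: div_Suc)
    then have w: "w = n div m + 1" "Suc n div m = w" using 3 by auto
    then have "Suc n mod m = 0" by (simp add: div_Suc split: if_splits)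
    then have len: "Suc n = w * m" using w(2) by (metis add.right_neutral div_mult_mod_eq)
    \<comment> \<open>The number of edges that precede the block of \<open>w\<close>.\<close>
    let ?k = "(n div m) * m"
    have k: "?k \<le> n" by simp
    have wfH: "length H = n" "\<And>e. e < n \<Longrightarrow> ?G ! e \<in>
        (if e < 2 * m then {1..2} \<times> {1..2} else {e div m + 1} \<times> {1..e div m + 1})"
      using wf[OF n H] by auto
    have "vertex_degree (take ?k ?G') w = 0"
    proof (rule vertex_degree_eq_0)
      fix e assume e: "e < length (take ?k ?G')"
      then have e': "e < ?k" by simp
      then have e'': "e < n" using k by linarith
      then have "take ?k ?G' ! e = ?G ! e" using e' e'' wfH(1) by (simp add: nth_append)
      moreover have "e div m < n div m" using e' m by (simp add: div_less_iff_less_mult)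
      moreover have "2 < w" using div_ge_2[OF n] w(1) by simp
      ultimately show "fst (take ?k ?G' ! e) \<noteq> w \<and> snd (take ?k ?G' ! e) \<noteq> w"
        using wfH(2)[OF e''] w(1) by (cases "?G ! e") (auto split: if_splits)
    qed
    moreover have "vertex_degree (drop ?k ?G') w \<le> 2 * length (drop ?k ?G')"
      by (rule vertex_degree_le)
    moreover have "length (drop ?k ?G') = m"
    proof -
      have "length (drop ?k ?G') = Suc n - ?k" using wfH(1) by (simp only: length_drop length_map) simp
      moreover have "Suc n = m + ?k" using len w(1) by simp
      ultimately show ?thesis by (simp only: diff_add_inverse2)
    qed
    moreover have "vertex_degree ?G' w = vertex_degree (take ?k ?G') w + vertex_degree (drop ?k ?G') w"
      by (metis append_take_drop_id vertex_degree_append)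
    ultimately have "vertex_degree ?G' w \<le> 4 * m" by linarith
    then have "real (vertex_degree ?G' w) \<le> 4 * real m" by (metis of_nat_le_iff of_nat_mult of_nat_numeral)
    then show ?thesis using 3 by (simp add: mass_def)
  qed
qed

text \<open>In both cases the masses cancel against the attachment law. Without a prescription at
  \<open>n\<close>, the mean growth is at most 1 plus the number of waiting prescriptions over
  \<open>norm_at n\<close>. With one, the required hit has probability at most mass over
  \<open>norm_at n\<close>, and \<open>potential\<close> loses exactly that mass.\<close>

lemma expected_step:
  assumes n: "2 * m \<le> n" and H: "H \<in> set_pmf (\<mu> n)"
  defines "G' \<equiv> \<lambda>i. relabel \<phi> (H @ [(c n, i)])"
  shows "(\<integral>\<^sup>+i. ennreal (of_bool (hits (Suc n) (G' i)) * potential (Suc n) (G' i)) \<partial>measure_pmf (K n H))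
    \<le> ennreal (growth n) *
        ennreal (of_bool (hits n (relabel \<phi> H)) * potential n (relabel \<phi> H))"
proof -
  define G where "G = relabel \<phi> H"
  let ?T = "n div m" and ?U = "\<tau> ` S" and ?Q = "map_pmf \<phi> (K n H)"
  have finU: "finite ?U" using S by simp
  have len: "length G = n" using wf[OF n H] by (simp add: G_def)
  have N: "0 < norm_at n" by (rule norm_at_pos[OF n])
  have Q: "pmf ?Q w \<le> mass n G w / norm_at n" if "w \<le> ?T" for w
    using attachment[OF n H that] that by (simp add: G_def mass_def norm_at_def)
  have G': "G' i = G @ [(n div m + 1, \<phi> i)]" for i by (simp add: G'_def G_def label)
  have hits_Suc: "hits (Suc n) (G' i) \<longleftrightarrow> hits n G \<and> (n \<in> S \<longrightarrow> \<phi> i = \<tau> n)" for i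
    unfolding hits_def G' using len by (auto simp: less_Suc_eq nth_append)
  have mass': "mass (Suc n) (G' i) w \<le> mass n G w + of_bool (\<phi> i = w \<and> w \<le> ?T)"
    if "i \<in> set_pmf (K n H)" for i w
    using mass_Suc_le[OF n H that] by (simp add: G'_def G_def)
  have potential': "potential (Suc n) (G' i) \<le>
      (\<Prod>w\<in>?U. pochhammer (mass n G w + of_bool (\<phi> i = w \<and> w \<le> ?T)) (pending (Suc n) w))"
    if "i \<in> set_pmf (K n H)" for i
    unfolding potential_def
    by (intro prod_mono conjI pochhammer_mono mass_pos mass' that less_imp_le[OF pochhammer_pos])
  have pot0: "0 < potential n G" by (rule potential_pos)
  show ?thesis
  proof (cases "hits n G")
    case False
    then show ?thesis by (simp add: hits_Suc)
  next
    case hit: True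
    show ?thesis
    proof (cases "n \<in> S")
      case False
      define b where "b w = real (pending n w) / mass n G w" for w
      define V where "V = {w \<in> ?U. w \<le> ?T}"
      have V: "finite V" using finU by (simp add: V_def)
      have b: "0 \<le> b w" for w using mass_pos[of n G w] by (simp add: b_def)
      have "e \<in> S \<Longrightarrow> Suc n \<le> e \<longleftrightarrow> n \<le> e" for e using False by (cases "e = n") auto
      then have pending_Suc: "pending (Suc n) w = pending n w" for w
        unfolding pending_def by (intro arg_cong[where f = card]) auto
      \<comment> \<open>An edge raises the mass of at most one completed vertex,
        \<open>\<phi> i\<close>, so only one factor of the product changes. Writing the change as a
        sum of indicators makes its mean immediate.\<close>
      have bound: "potential (Suc n) (G' i) \<le> potential n G * (1 + (\<Sum>w\<in>V. of_bool (\<phi> i = w) * b w))"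
        if i: "i \<in> set_pmf (K n H)" for i
      proof -
        have "pochhammer (mass n G w + of_bool (\<phi> i = w \<and> w \<le> ?T)) (pending (Suc n) w) =
            pochhammer (mass n G w) (pending n w) *
              (if w = \<phi> i then (if \<phi> i \<le> ?T then 1 + b (\<phi> i) else 1) else 1)" for w
          by (cases "\<phi> i = w \<and> w \<le> ?T")
            (auto simp: pending_Suc b_def pochhammer_add_one[OF mass_pos])
        then have "potential (Suc n) (G' i) \<le>
            (\<Prod>w\<in>?U. pochhammer (mass n G w) (pending n w) *
              (if w = \<phi> i then (if \<phi> i \<le> ?T then 1 + b (\<phi> i) else 1) else 1))"
          using potential'[OF i] by (simp only:)
        also have "\<dots> = potential n G *
            (\<Prod>w\<in>?U. if w = \<phi> i then (if \<phi> i \<le> ?T then 1 + b (\<phi> i) else 1) else 1)"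
          by (simp add: prod.distrib potential_def)
        also have "(\<Prod>w\<in>?U. if w = \<phi> i then (if \<phi> i \<le> ?T then 1 + b (\<phi> i) else 1) else 1) =
            (if \<phi> i \<in> V then 1 + b (\<phi> i) else 1)"
          using finU by (auto simp: prod.delta V_def)
        also have "\<dots> = 1 + (\<Sum>w\<in>V. if w = \<phi> i then b (\<phi> i) else 0)"
          using V by (simp add: sum.delta)
        also have "(\<Sum>w\<in>V. if w = \<phi> i then b (\<phi> i) else 0) = (\<Sum>w\<in>V. of_bool (\<phi> i = w) * b w)"
          by (intro sum.cong) auto
        finally show ?thesis .
      qed
      \<comment> \<open>Every waiting prescription with a completed target is counted once, at its
        own target; this trades the sum over vertices for a product over prescriptions.\<close>
      have "(\<Sum>w\<in>V. pending n w) = card (\<Union>w\<in>V. {e \<in> S. n \<le> e \<and> \<tau> e = w})"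
        unfolding pending_def using S V by (intro card_UN_disjoint[symmetric]) auto
      also have "(\<Union>w\<in>V. {e \<in> S. n \<le> e \<and> \<tau> e = w}) = {e \<in> S. n < e \<and> \<tau> e \<le> ?T}"
        using False by (auto simp: V_def le_less)
      finally have pend: "(\<Sum>w\<in>V. pending n w) = card {e \<in> S. n < e \<and> \<tau> e \<le> ?T}" .
      have "(\<Sum>w\<in>V. pmf ?Q w * b w) \<le> (\<Sum>w\<in>V. real (pending n w) / norm_at n)"
      proof (rule sum_mono)
        fix w assume "w \<in> V"
        then have "pmf ?Q w * b w \<le> mass n G w / norm_at n * b w"
          by (intro mult_right_mono Q b) (simp add: V_def)
        also have "\<dots> = real (pending n w) / norm_at n"
          using mass_pos[of n G w] by (simp add: b_def)
        finally show "pmf ?Q w * b w \<le> real (pending n w) / norm_at n" .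
      qed
      also have "\<dots> = real (card {e \<in> S. n < e \<and> \<tau> e \<le> ?T}) / norm_at n"
        by (simp add: pend[symmetric] sum_divide_distrib)
      finally have "1 + (\<Sum>w\<in>V. pmf ?Q w * b w) \<le>
          exp (real (card {e \<in> S. n < e \<and> \<tau> e \<le> ?T}) / norm_at n)"
        using exp_ge_add_one_self[of "real (card {e \<in> S. n < e \<and> \<tau> e \<le> ?T}) / norm_at n"] by linarith
      also have "\<dots> = (\<Prod>e\<in>{e \<in> S. n < e \<and> \<tau> e \<le> ?T}. exp (1 / norm_at n))"
        by (simp add: exp_of_nat_mult[symmetric])
      also have "\<dots> = growth n"
        using False S by (simp add: growth_def prod.inter_filter del: prod_constant)
      finally have growth: "1 + (\<Sum>w\<in>V. pmf ?Q w * b w) \<le> growth n" .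
      have "(\<integral>\<^sup>+i. ennreal (of_bool (hits (Suc n) (G' i)) * potential (Suc n) (G' i)) \<partial>measure_pmf (K n H))
          \<le> (\<integral>\<^sup>+i. ennreal (potential n G) * ennreal (1 + (\<Sum>w\<in>V. of_bool (\<phi> i = w) * b w))
              \<partial>measure_pmf (K n H))"
      proof (rule nn_integral_mono_AE, rule AE_pmfI)
        fix i assume "i \<in> set_pmf (K n H)"
        then have "ennreal (of_bool (hits (Suc n) (G' i)) * potential (Suc n) (G' i))
            \<le> ennreal (potential n G * (1 + (\<Sum>w\<in>V. of_bool (\<phi> i = w) * b w)))"
          using bound[of i] hit False by (intro ennreal_leI) (simp add: hits_Suc)
        also have "\<dots> = ennreal (potential n G) * ennreal (1 + (\<Sum>w\<in>V. of_bool (\<phi> i = w) * b w))"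
          using pot0 b by (intro ennreal_mult) (auto intro!: add_nonneg_nonneg sum_nonneg)
        finally show "ennreal (of_bool (hits (Suc n) (G' i)) * potential (Suc n) (G' i))
            \<le> ennreal (potential n G) * ennreal (1 + (\<Sum>w\<in>V. of_bool (\<phi> i = w) * b w))" .
      qed
      also have "\<dots> = ennreal (potential n G) *
          (\<integral>\<^sup>+u. ennreal (1 + (\<Sum>w\<in>V. of_bool (u = w) * b w)) \<partial>measure_pmf ?Q)"
        by (simp add: nn_integral_cmult)
      also have "\<dots> = ennreal (potential n G) * ennreal (1 + (\<Sum>w\<in>V. pmf ?Q w * b w))"
        by (subst nn_integral_pmf_point_weights[OF V b]) (rule refl)
      also have "\<dots> \<le> ennreal (potential n G) * ennreal (growth n)"
        by (intro mult_left_mono ennreal_leI growth) simp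
      finally show ?thesis using hit by (simp add: G_def mult.commute)
    next
      case True
      define w0 where "w0 = \<tau> n"
      have w0: "w0 \<in> ?U" "w0 \<le> ?T" using True \<tau> by (auto simp: w0_def)
      have pending: "pending n w = (if w = w0 then Suc (pending (Suc n) w) else pending (Suc n) w)" for w
      proof -
        have "{e \<in> S. n \<le> e \<and> \<tau> e = w} =
            (if w = w0 then insert n {e \<in> S. Suc n \<le> e \<and> \<tau> e = w} else {e \<in> S. Suc n \<le> e \<and> \<tau> e = w})"
          using True by (auto simp: w0_def Suc_le_eq le_less)
        then show ?thesis using S by (simp add: pending_def)
      qed
      \<comment> \<open>By \<open>pochhammer x (Suc r) = x * pochhammer (x + 1) r\<close>, using up
        one prescription while the mass of its target rises by 1 divides \<open>potential\<close> by
        the old mass.\<close>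
      have "potential n G = (\<Prod>w\<in>?U. (if w = w0 then mass n G w0 else 1) *
          pochhammer (mass n G w + of_bool (w = w0)) (pending (Suc n) w))"
        unfolding potential_def by (intro prod.cong refl) (simp add: pending pochhammer_rec)
      also have "\<dots> = mass n G w0 *
          (\<Prod>w\<in>?U. pochhammer (mass n G w + of_bool (w = w0)) (pending (Suc n) w))"
        using finU w0 by (simp add: prod.distrib prod.delta)
      finally have pot: "(\<Prod>w\<in>?U. pochhammer (mass n G w + of_bool (w = w0)) (pending (Suc n) w)) =
          potential n G / mass n G w0"
        using mass_pos[of n G w0] by (simp add: field_simps)
      have bound: "potential (Suc n) (G' i) \<le> potential n G / mass n G w0"
        if i: "i \<in> set_pmf (K n H)" "\<phi> i = w0" for i
      proof -
        have "of_bool (\<phi> i = w \<and> w \<le> ?T) = (of_bool (w = w0) :: real)" for w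
          using i(2) w0(2) by auto
        then show ?thesis using potential'[OF i(1)] pot by simp
      qed
      have "(\<integral>\<^sup>+i. ennreal (of_bool (hits (Suc n) (G' i)) * potential (Suc n) (G' i)) \<partial>measure_pmf (K n H))
          \<le> (\<integral>\<^sup>+i. ennreal (potential n G / mass n G w0) * indicator {w0} (\<phi> i) \<partial>measure_pmf (K n H))"
      proof (rule nn_integral_mono_AE, rule AE_pmfI)
        fix i assume "i \<in> set_pmf (K n H)"
        then show "ennreal (of_bool (hits (Suc n) (G' i)) * potential (Suc n) (G' i))
            \<le> ennreal (potential n G / mass n G w0) * indicator {w0} (\<phi> i)"
          using bound[of i] hit True by (cases "\<phi> i = w0") (auto simp: hits_Suc w0_def ennreal_leI)
      qed
      also have "\<dots> = (\<integral>\<^sup>+u. ennreal (potential n G / mass n G w0) * indicator {w0} u \<partial>measure_pmf ?Q)"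
        by simp
      also have "\<dots> = ennreal (potential n G / mass n G w0) * ennreal (pmf ?Q w0)"
        by (subst nn_integral_cmult_indicator) (simp_all add: emeasure_pmf_single del: nn_integral_map_pmf)
      also have "\<dots> = ennreal (potential n G / mass n G w0 * pmf ?Q w0)"
        using pot0 mass_pos[of n G w0] by (intro ennreal_mult[symmetric]) auto
      also have "potential n G / mass n G w0 * pmf ?Q w0
          \<le> potential n G / mass n G w0 * (mass n G w0 / norm_at n)"
        using pot0 mass_pos[of n G w0] by (intro mult_left_mono Q w0(2)) simp
      also have "\<dots> = 1 / norm_at n * potential n G"
        using mass_pos[of n G w0] by simp
      also have "\<dots> \<le> growth n * potential n G"
      proof (rule mult_right_mono)
        have "1 \<le> (\<Prod>e\<in>S. if n < e \<and> \<tau> e \<le> ?T then exp (1 / norm_at n) else 1)"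
          using N by (intro prod_ge_1) auto
        then show "1 / norm_at n \<le> growth n"
          using N True mult_left_mono[of 1 _ "1 / norm_at n"] by (simp add: growth_def)
      qed (use pot0 in simp)
      finally show ?thesis
        using hit pot0 growth_nonneg[OF n] by (simp add: G_def ennreal_mult ennreal_leI)
    qed
  qed
qed

lemma nn_integral_potential_le:
  assumes "2 * m \<le> N" and two: "\<And>w. card {e \<in> S. \<tau> e = w} \<le> 2"
  shows "(\<integral>\<^sup>+H. ennreal (of_bool (hits N (relabel \<phi> H)) * potential N (relabel \<phi> H)) \<partial>measure_pmf (\<mu> N))
    \<le> ennreal ((\<Prod>n=2 * m..<N. growth n) * (4 * real m + 1 + \<delta>) ^ card S)"
  using assms(1)
proof (induction N rule: dec_induct)
  case base
  \<comment> \<open>Each of the \<open>2 * m\<close> initial edges adds at most 2 to a degree, so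
    every mass is at most \<open>4 * m + \<delta>\<close>. The extra 1 covers the second factor of a
    rising factorial, as at most two prescriptions share a target.\<close>
  let ?B = "4 * real m + 1 + \<delta>"
  have "potential (2 * m) (relabel \<phi> H) \<le> ?B ^ card S" if H: "H \<in> set_pmf (\<mu> (2 * m))" for H
  proof -
    have mass: "mass (2 * m) (relabel \<phi> H) w \<le> 4 * real m + \<delta>" for w
    proof -
      have "vertex_degree (relabel \<phi> H) w \<le> 2 * length (relabel \<phi> H)" by (rule vertex_degree_le)
      then have "vertex_degree (relabel \<phi> H) w \<le> 4 * m" using init[OF H] by simp
      then have "real (vertex_degree (relabel \<phi> H) w) \<le> real (4 * m)" by (rule of_nat_mono)
      then show ?thesis by (simp add: mass_def)
    qed
    have "pochhammer (mass (2 * m) (relabel \<phi> H) w) (pending (2 * m) w) \<le> ?B ^ pending (2 * m) w" for w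
    proof -
      have "pending (2 * m) w \<le> card {e \<in> S. \<tau> e = w}"
        unfolding pending_def using S by (intro card_mono) auto
      then have p: "pending (2 * m) w \<le> 2" using two[of w] by linarith
      have "(\<Prod>i=0..<pending (2 * m) w. mass (2 * m) (relabel \<phi> H) w + of_nat i)
          \<le> (\<Prod>i=0..<pending (2 * m) w. ?B)"
      proof (intro prod_mono conjI)
        fix i assume "i \<in> {0..<pending (2 * m) w}"
        then have "real i \<le> 1" using p by simp
        then show "mass (2 * m) (relabel \<phi> H) w + of_nat i \<le> ?B" using mass[of w] by simp
        show "0 \<le> mass (2 * m) (relabel \<phi> H) w + of_nat i"
          using mass_pos[of "2 * m" "relabel \<phi> H" w] by simp
      qed
      then show ?thesis by (simp add: pochhammer_prod)
    qed
    then have "potential (2 * m) (relabel \<phi> H) \<le> (\<Prod>w\<in>\<tau> ` S. ?B ^ pending (2 * m) w)"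
      unfolding potential_def
      by (intro prod_mono conjI less_imp_le[OF pochhammer_pos] mass_pos) auto
    also have "\<dots> = ?B ^ (\<Sum>w\<in>\<tau> ` S. pending (2 * m) w)" by (simp add: power_sum)
    also have "(\<Sum>w\<in>\<tau> ` S. pending (2 * m) w) = card (\<Union>w\<in>\<tau> ` S. {e \<in> S. 2 * m \<le> e \<and> \<tau> e = w})"
      unfolding pending_def using S by (intro card_UN_disjoint[symmetric]) auto
    also have "(\<Union>w\<in>\<tau> ` S. {e \<in> S. 2 * m \<le> e \<and> \<tau> e = w}) = S" using \<tau> by auto
    finally show ?thesis .
  qed
  then have "(\<integral>\<^sup>+H. ennreal (of_bool (hits (2 * m) (relabel \<phi> H)) * potential (2 * m) (relabel \<phi> H))
      \<partial>measure_pmf (\<mu> (2 * m))) \<le> (\<integral>\<^sup>+H. ennreal (?B ^ card S) \<partial>measure_pmf (\<mu> (2 * m)))"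
    using \<delta> by (intro nn_integral_mono_AE AE_pmfI ennreal_leI) (simp add: of_bool_def)
  then show ?case by simp
next
  case (step N)
  let ?f = "\<lambda>n H. ennreal (of_bool (hits n (relabel \<phi> H)) * potential n (relabel \<phi> H))"
  let ?B = "(4 * real m + 1 + \<delta>) ^ card S"
  have "(\<integral>\<^sup>+H. ?f (Suc N) H \<partial>measure_pmf (\<mu> (Suc N))) =
      (\<integral>\<^sup>+H. \<integral>\<^sup>+i. ?f (Suc N) (H @ [(c N, i)]) \<partial>measure_pmf (K N H) \<partial>measure_pmf (\<mu> N))"
    unfolding pa_chain.step[OF pa_chain_axioms step.hyps(1)] by simp
  also have "\<dots> \<le> (\<integral>\<^sup>+H. ennreal (growth N) * ?f N H \<partial>measure_pmf (\<mu> N))"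
    by (intro nn_integral_mono_AE AE_pmfI expected_step step.hyps(1))
  also have "\<dots> = ennreal (growth N) * (\<integral>\<^sup>+H. ?f N H \<partial>measure_pmf (\<mu> N))"
    by (simp add: nn_integral_cmult)
  also have "\<dots> \<le> ennreal (growth N) * ennreal ((\<Prod>n=2 * m..<N. growth n) * ?B)"
    by (intro mult_left_mono step.IH) simp
  also have "\<dots> = ennreal ((\<Prod>n=2 * m..<Suc N. growth n) * ?B)"
    using step.hyps growth_nonneg \<delta>
    by (subst ennreal_mult[symmetric]) (auto intro!: mult_nonneg_nonneg prod_nonneg simp: mult_ac)
  finally show ?case .
qed

text \<open>At time \<open>N\<close> no prescription is left, every rising factorial has exponent 0,
  and the integral of \<open>potential\<close> over the event is its probability.\<close>

lemma prob_hits_le_growth: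
  assumes "S \<subseteq> {2 * m..<N}" "2 * m \<le> N" "\<And>w. card {e \<in> S. \<tau> e = w} \<le> 2"
  shows "measure_pmf.prob (\<mu> N) {H. \<forall>e\<in>S. snd (relabel \<phi> H ! e) = \<tau> e}
    \<le> (\<Prod>n=2 * m..<N. growth n) * (4 * real m + 1 + \<delta>) ^ card S"
proof -
  let ?A = "{H. \<forall>e\<in>S. snd (relabel \<phi> H ! e) = \<tau> e}"
  let ?b = "(\<Prod>n=2 * m..<N. growth n) * (4 * real m + 1 + \<delta>) ^ card S"
  have "{e \<in> S. N \<le> e \<and> \<tau> e = w} = {}" for w using assms(1) by auto
  then have "pending N w = 0" for w by (simp only: pending_def card.empty)
  then have "potential N G = 1" for G by (simp add: potential_def)
  moreover have "hits N (relabel \<phi> H) \<longleftrightarrow> H \<in> ?A" for H using assms(1) by (auto simp: hits_def)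
  ultimately have "(\<integral>\<^sup>+H. indicator ?A H \<partial>measure_pmf (\<mu> N)) =
      (\<integral>\<^sup>+H. ennreal (of_bool (hits N (relabel \<phi> H)) * potential N (relabel \<phi> H)) \<partial>measure_pmf (\<mu> N))"
    by (intro nn_integral_cong) (simp add: indicator_def)
  also have "\<dots> \<le> ennreal ?b" by (rule nn_integral_potential_le[OF assms(2,3)])
  finally have "emeasure (measure_pmf (\<mu> N)) ?A \<le> ennreal ?b" by simp
  moreover have "0 \<le> ?b" using growth_nonneg \<delta> by (auto intro!: mult_nonneg_nonneg prod_nonneg)
  ultimately show ?thesis by (simp add: measure_pmf.emeasure_eq_measure)
qed

end
end

section \<open>From growth factors to path probabilities\<close>

lemma sum_div_blocks:
  fixes h :: "nat \<Rightarrow> real"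
  assumes "a \<le> b" "0 < m"
  shows "(\<Sum>n=m * a..<m * b. h (n div m)) = real m * (\<Sum>T=a..<b. h T)"
  using assms(1)
proof (induction b rule: dec_induct)
  case (step b)
  have "(\<Sum>n=m * a..<m * Suc b. h (n div m)) =
      (\<Sum>n=m * a..<m * b. h (n div m)) + (\<Sum>n=m * b..<m * Suc b. h (n div m))"
    using step by (intro sum.atLeastLessThan_concat[symmetric]) auto
  also have "(\<Sum>n=m * b..<m * Suc b. h (n div m)) = (\<Sum>n=m * b..<m * Suc b. h b)"
  proof (intro sum.cong refl)
    fix n assume "n \<in> {m * b..<m * Suc b}"
    then have "n div m = b" by (intro div_nat_eqI) (auto simp: mult.commute)
    then show "h (n div m) = h b" by simp
  qed
  finally show ?case using step by (simp add: algebra_simps)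
qed simp

lemma sum_inverse_le:
  assumes "1 \<le> a" "a \<le> b"
  shows "(\<Sum>T=a..b. 1 / real T) \<le> 1 + ln (real b / real a)"
  using assms(2)
proof (induction b rule: dec_induct)
  case base
  then show ?case using assms(1) by simp
next
  case (step b)
  have b: "0 < b" using step assms by simp
  have "ln (real b / real (Suc b)) \<le> real b / real (Suc b) - 1"
    using b by (intro ln_le_minus_one) simp
  also have "\<dots> = - (1 / real (Suc b))" by (simp add: field_simps)
  finally have "1 / real (Suc b) \<le> ln (real (Suc b)) - ln (real b)"
    using b by (simp add: ln_div)
  moreover have "(\<Sum>T=a..Suc b. 1 / real T) = (\<Sum>T=a..b. 1 / real T) + 1 / real (Suc b)"
    using step by simp
  ultimately show ?case using step.IH assms b by (simp add: ln_div)
qed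

lemma pa_kernel_nonneg: "0 \<le> C \<Longrightarrow> 0 \<le> pa_kernel C \<gamma> u v"
  by (simp add: pa_kernel_def)

text \<open>This excludes that a single edge of the graph serves two different steps of a
  path.\<close>

lemma consecutive_pair_inj:
  assumes "distinct xs" "Suc i < length xs" "Suc j < length xs"
    and "max (xs ! i) (xs ! Suc i) = max (xs ! j) (xs ! Suc j)"
    and "min (xs ! i) (xs ! Suc i) = min (xs ! j) (xs ! Suc j)"
  shows "i = (j :: nat)"
proof -
  have "xs ! i = xs ! j \<or> xs ! i = xs ! Suc j \<and> xs ! Suc i = xs ! j"
    using assms(4,5) by (auto simp: max_def min_def split: if_splits)
  then show ?thesis
    using assms(1-3) by (auto simp: nth_eq_iff_index_eq)
qed

text \<open>Source of the bound of two prescriptions per target: a vertex of a path lies on at most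
  two of its steps.\<close>

lemma card_incident_pairs_le:
  assumes "distinct xs"
  shows "card {i. Suc i < length xs \<and> (xs ! i = w \<or> xs ! Suc i = w)} \<le> 2" (is "card ?I \<le> 2")
proof (cases "w \<in> set xs")
  case True
  then obtain j where j: "j < length xs" "xs ! j = w" by (auto simp: in_set_conv_nth)
  have "?I \<subseteq> {j, j - 1}" using assms j by (auto simp: nth_eq_iff_index_eq)
  then have "card ?I \<le> card {j, j - 1}" by (intro card_mono) auto
  then show ?thesis by (auto simp: card_insert_if split: if_splits)
next
  case False
  then have "?I = {}" by (auto simp: in_set_conv_nth)
  then show ?thesis by (simp only: card.empty)
qed

definition attach_exponent :: "nat \<Rightarrow> real \<Rightarrow> real" where
  "attach_exponent m \<delta> = real m / (2 * real m + \<delta>)"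

text \<open>The first factor bounds the initial contribution of one prescription to
  \<open>potential\<close>; \<open>exp 1\<close> absorbs the additive 1 in the logarithmic bound for
  harmonic sums.\<close>

definition edge_const :: "nat \<Rightarrow> real \<Rightarrow> real" where
  "edge_const m \<delta> = (4 * real m + 1 + \<delta>) * exp 1"

lemma edge_const_ge:
  assumes "1 \<le> m" "0 < \<delta>"
  shows "5 \<le> edge_const m \<delta>"
proof -
  have "5 * 1 \<le> (4 * real m + 1 + \<delta>) * exp 1"
    using assms one_le_exp_iff[of 1] by (intro mult_mono) auto
  then show ?thesis by (simp add: edge_const_def)
qed

lemma attach_exponent_bounds:
  assumes "1 \<le> m" "0 < \<delta>"
  shows "0 \<le> attach_exponent m \<delta>" "attach_exponent m \<delta> < 1 / 2"
  using assms by (auto simp: attach_exponent_def field_simps)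

context pa_chain
begin

abbreviation "\<gamma> \<equiv> attach_exponent m \<delta>"

lemmas \<gamma> = attach_exponent_bounds[OF m \<delta>]

text \<open>The left side collects everything that one prescribed edge contributes: its initial
  mass, the hit, and the growth between the completion of its target and its own creation.\<close>

lemma edge_factor_le:
  assumes e: "2 * m \<le> e" "e < N" and lo: "1 \<le> lo" "lo \<le> e div m"
  shows "(4 * real m + 1 + \<delta>) / norm_at e *
      (\<Prod>n=2 * m..<N. if n < e \<and> lo \<le> n div m then exp (1 / norm_at n) else 1)
    \<le> pa_kernel (edge_const m \<delta>) \<gamma> (e div m + 1) lo"
proof -
  define hi where "hi = e div m + 1"
  have hi: "3 \<le> hi" "lo < hi" using div_ge_2[OF e(1)] lo by (auto simp: hi_def)
  have m0: "0 < m" using m by simp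
  let ?d = "2 * real m + \<delta>" and ?X = "{n \<in> {2 * m..<N}. n < e \<and> lo \<le> n div m}"
  have d: "2 \<le> ?d" using m \<delta> by linarith
  have "e < m * hi" using m0 dividend_less_times_div[of m e] by (simp add: hi_def)
  then have X: "?X \<subseteq> {m * lo..<m * hi}"
    using m0 by (auto simp: less_eq_div_iff_mult_less_eq mult.commute)
  have "(\<Sum>n\<in>?X. 1 / norm_at n) \<le> (\<Sum>n=m * lo..<m * hi. 1 / norm_at n)"
    using X \<delta> by (intro sum_mono2) (auto simp: norm_at_def)
  also have "\<dots> = (\<Sum>n=m * lo..<m * hi. (\<lambda>T. 1 / (real T * ?d)) (n div m))"
    by (simp add: norm_at_def)
  \<comment> \<open>The \<open>m\<close> edges that see \<open>T\<close> vertices contribute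
    together \<open>m / (T * (2 * m + \<delta>)) = \<gamma> / T\<close>; this is where the exponent
    of the kernel comes from.\<close>
  also have "\<dots> = real m * (\<Sum>T=lo..<hi. 1 / (real T * ?d))"
    using hi m0 by (intro sum_div_blocks) auto
  also have "\<dots> = \<gamma> * (\<Sum>T=lo..<hi. 1 / real T)"
    unfolding attach_exponent_def sum_distrib_left by (intro sum.cong refl) simp
  also have "{lo..<hi} = {lo..hi - 1}" using hi by auto
  also have "\<gamma> * (\<Sum>T=lo..hi - 1. 1 / real T) \<le> \<gamma> * (1 + ln (real (hi - 1) / real lo))"
    using hi lo \<gamma> by (intro mult_left_mono sum_inverse_le) auto
  also have "\<dots> \<le> \<gamma> * (1 + ln (real hi / real lo))"
    using hi lo \<gamma> by (intro mult_left_mono add_left_mono ln_mono divide_right_mono) auto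
  also have "\<dots> \<le> 1 + \<gamma> * ln (real hi / real lo)" using \<gamma> by (simp add: algebra_simps)
  finally have exponent: "(\<Sum>n\<in>?X. 1 / norm_at n) \<le> 1 + \<gamma> * ln (real hi / real lo)" .
  have "(\<Prod>n=2 * m..<N. if n < e \<and> lo \<le> n div m then exp (1 / norm_at n) else 1) =
      (\<Prod>n\<in>?X. exp (1 / norm_at n))"
    by (rule prod.inter_filter[symmetric]) simp
  also have "\<dots> = exp (\<Sum>n\<in>?X. 1 / norm_at n)" by (simp add: exp_sum)
  also have "\<dots> \<le> exp (1 + \<gamma> * ln (real hi / real lo))" using exponent by simp
  also have "\<dots> = exp 1 * (real hi powr \<gamma> * real lo powr (- \<gamma>))"
    using hi lo by (simp add: exp_add powr_def ln_div algebra_simps flip: exp_add)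
  finally have product: "(\<Prod>n=2 * m..<N. if n < e \<and> lo \<le> n div m then exp (1 / norm_at n) else 1)
      \<le> exp 1 * (real hi powr \<gamma> * real lo powr (- \<gamma>))" .
  have "real hi \<le> (real hi - 1) * 2" using hi by simp
  also have "\<dots> \<le> (real hi - 1) * ?d" using d hi by (intro mult_left_mono) auto
  also have "\<dots> = norm_at e" using hi by (simp add: norm_at_def hi_def)
  finally have "(4 * real m + 1 + \<delta>) / norm_at e \<le> (4 * real m + 1 + \<delta>) / real hi"
    using hi \<delta> by (intro divide_left_mono mult_pos_pos) auto
  then have "(4 * real m + 1 + \<delta>) / norm_at e *
      (\<Prod>n=2 * m..<N. if n < e \<and> lo \<le> n div m then exp (1 / norm_at n) else 1)
    \<le> (4 * real m + 1 + \<delta>) / real hi * (exp 1 * (real hi powr \<gamma> * real lo powr (- \<gamma>)))"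
    using product \<delta> by (intro mult_mono prod_nonneg) auto
  also have "\<dots> = pa_kernel (edge_const m \<delta>) \<gamma> hi lo"
    using hi by (simp add: pa_kernel_def edge_const_def powr_diff max_def min_def)
  finally show ?thesis by (simp add: hi_def)
qed

text \<open>After exchanging the products over time and over prescriptions, each prescribed edge
  carries its own factor, which \<open>edge_factor_le\<close> bounds by the kernel.\<close>

lemma prob_positions_le:
  assumes "S \<subseteq> {2 * m..<N}" and \<tau>: "\<And>e. e \<in> S \<Longrightarrow> 1 \<le> \<tau> e \<and> \<tau> e \<le> e div m"
    and "2 * m \<le> N" "\<And>w. card {e \<in> S. \<tau> e = w} \<le> 2"
  shows "measure_pmf.prob (\<mu> N) {H. \<forall>e\<in>S. snd (relabel \<phi> H ! e) = \<tau> e}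
    \<le> (\<Prod>e\<in>S. pa_kernel (edge_const m \<delta>) \<gamma> (e div m + 1) (\<tau> e))"
proof -
  let ?B = "4 * real m + 1 + \<delta>"
  let ?g = "\<lambda>n e. if n < e \<and> \<tau> e \<le> n div m then exp (1 / norm_at n) else 1"
  have S: "finite S" "\<And>e. e \<in> S \<Longrightarrow> 2 * m \<le> e \<and> \<tau> e \<le> e div m"
    using assms(1) \<tau> by (auto intro: finite_subset)
  have "measure_pmf.prob (\<mu> N) {H. \<forall>e\<in>S. snd (relabel \<phi> H ! e) = \<tau> e}
      \<le> (\<Prod>n=2 * m..<N. growth S \<tau> n) * ?B ^ card S"
    using S assms by (intro prob_hits_le_growth) auto
  also have "(\<Prod>n=2 * m..<N. growth S \<tau> n) =
      (\<Prod>n=2 * m..<N. if n \<in> S then 1 / norm_at n else 1) * (\<Prod>n=2 * m..<N. \<Prod>e\<in>S. ?g n e)"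
    by (simp add: growth_def[OF S] prod.distrib)
  also have "(\<Prod>n=2 * m..<N. if n \<in> S then 1 / norm_at n else 1) = (\<Prod>e\<in>S. 1 / norm_at e)"
    using assms(1) by (subst prod.inter_restrict[symmetric]) (auto simp: Int_absorb1)
  also have "(\<Prod>n=2 * m..<N. \<Prod>e\<in>S. ?g n e) = (\<Prod>e\<in>S. \<Prod>n=2 * m..<N. ?g n e)"
    by (rule prod.swap)
  also have "(\<Prod>e\<in>S. 1 / norm_at e) * (\<Prod>e\<in>S. \<Prod>n=2 * m..<N. ?g n e) * ?B ^ card S =
      (\<Prod>e\<in>S. ?B / norm_at e * (\<Prod>n=2 * m..<N. ?g n e))"
    by (simp add: prod.distrib prod_dividef)
  also have "\<dots> \<le> (\<Prod>e\<in>S. pa_kernel (edge_const m \<delta>) \<gamma> (e div m + 1) (\<tau> e))"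
  proof (intro prod_mono conjI)
    fix e assume e: "e \<in> S"
    then have e': "2 * m \<le> e" "e < N" "1 \<le> \<tau> e" "\<tau> e \<le> e div m" using assms(1) \<tau> by auto
    show "?B / norm_at e * (\<Prod>n=2 * m..<N. ?g n e) \<le> pa_kernel (edge_const m \<delta>) \<gamma> (e div m + 1) (\<tau> e)"
      by (rule edge_factor_le[OF e'])
    show "0 \<le> ?B / norm_at e * (\<Prod>n=2 * m..<N. ?g n e)"
      using norm_at_pos[OF e'(1)] \<delta> by (intro mult_nonneg_nonneg prod_nonneg) auto
  qed
  finally show ?thesis .
qed

text \<open>A pair whose larger vertex is at least 3 can only be joined by one of the
  \<open>m\<close> edges sent by that vertex. A choice of position for every such pair is an event
  of prescribed targets, and the union bound over the choices puts \<open>m\<close> into the kernel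
  constant.\<close>

lemma prob_path_le:
  assumes t: "2 \<le> t" and xs: "distinct xs" "set xs \<subseteq> {1..t}"
  shows "measure_pmf.prob (\<mu> (m * t)) {H. successively (\<lambda>u v. (u, v) \<in> adj (relabel \<phi> H)) xs}
    \<le> path_weight (pa_kernel (real m * edge_const m \<delta>) \<gamma>) xs"
proof -
  define hi where "hi i = max (xs ! i) (xs ! Suc i)" for i
  define lo where "lo i = min (xs ! i) (xs ! Suc i)" for i
  \<comment> \<open>The omitted step is the pair of vertices 1 and 2, whose edges depend on the
    model; it is bounded by probability 1 at the end.\<close>
  define J where "J = {i. Suc i < length xs \<and> 3 \<le> hi i}"
  define block where "block i = {(hi i - 1) * m..<hi i * m}" for i
  define A where "A f = {H \<in> set_pmf (\<mu> (m * t)). \<forall>i\<in>J. relabel \<phi> H ! f i = (hi i, lo i)}" for f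
  let ?P = "measure_pmf.prob (\<mu> (m * t))"
  let ?E = "{H. successively (\<lambda>u v. (u, v) \<in> adj (relabel \<phi> H)) xs}"
  let ?\<kappa>1 = "pa_kernel (edge_const m \<delta>) \<gamma>" and ?\<kappa> = "pa_kernel (real m * edge_const m \<delta>) \<gamma>"
  have m0: "0 < m" using m by simp
  have N: "2 * m \<le> m * t" using t by simp
  have C: "0 \<le> edge_const m \<delta>" using \<delta> by (simp add: edge_const_def)
  have finJ: "finite J" by (rule finite_subset[of _ "{..length xs}"]) (auto simp: J_def)
  have lohi: "1 \<le> lo i" "lo i < hi i" "hi i \<le> t" if "Suc i < length xs" for i
  proof -
    have "xs ! i \<noteq> xs ! Suc i" using that xs(1) by (simp add: nth_eq_iff_index_eq)
    moreover have "xs ! i \<in> {1..t}" "xs ! Suc i \<in> {1..t}" using that xs(2) by (auto simp: subset_iff)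
    ultimately show "1 \<le> lo i" "lo i < hi i" "hi i \<le> t" by (auto simp: hi_def lo_def)
  qed
  have block: "e div m + 1 = hi i" "2 * m \<le> e" "e < m * t" if "i \<in> J" "e \<in> block i" for i e
  proof -
    have h: "3 \<le> hi i" "hi i \<le> t" using that lohi[of i] by (auto simp: J_def)
    have "e div m = hi i - 1"
      using that(2) h by (intro div_nat_eqI) (auto simp: block_def mult.commute)
    then show "e div m + 1 = hi i" using h by simp
    have "2 * m \<le> (hi i - 1) * m" using h by (intro mult_right_mono) auto
    then show "2 * m \<le> e" using that(2) unfolding block_def atLeastLessThan_iff by linarith
    have "hi i * m \<le> t * m" using h by (intro mult_right_mono) auto
    then show "e < m * t"
      using that(2) unfolding block_def atLeastLessThan_iff mult.commute[of m t] by linarith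
  qed
  have cover: "?E \<inter> set_pmf (\<mu> (m * t)) \<subseteq> (\<Union>f\<in>PiE J block. A f)"
  proof
    fix H assume "H \<in> ?E \<inter> set_pmf (\<mu> (m * t))"
    then have succ: "successively (\<lambda>u v. (u, v) \<in> adj (relabel \<phi> H)) xs"
      and H: "H \<in> set_pmf (\<mu> (m * t))" by auto
    have "\<exists>e\<in>block i. relabel \<phi> H ! e = (hi i, lo i)" if i: "i \<in> J" for i
    proof -
      have si: "Suc i < length xs" using i by (simp add: J_def)
      have "(xs ! i, xs ! Suc i) \<in> adj (relabel \<phi> H)" using successively_nth[OF succ si] .
      then have "(hi i, lo i) \<in> set (relabel \<phi> H) \<or> (lo i, hi i) \<in> set (relabel \<phi> H)"
        by (auto simp: adj_def hi_def lo_def max_def min_def)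
      then obtain e where e: "e < length (relabel \<phi> H)"
        "relabel \<phi> H ! e = (hi i, lo i) \<or> relabel \<phi> H ! e = (lo i, hi i)"
        unfolding in_set_conv_nth by blast
      then have en: "e < m * t" using wf[OF N H] by simp
      have "relabel \<phi> H ! e \<in>
          (if e < 2 * m then {1..2} \<times> {1..2} else {e div m + 1} \<times> {1..e div m + 1})"
        using wf[OF N H] en by blast
      \<comment> \<open>The newer end point is stored first, so the reversed orientation is
        impossible, and \<open>hi i \<ge> 3\<close> rules out an initial edge.\<close>
      then have "relabel \<phi> H ! e = (hi i, lo i)" "hi i = e div m + 1"
        using e(2) i lohi(2)[OF si] by (auto simp: J_def split: if_splits)
      moreover have "(e div m) * m \<le> e" "e < (e div m + 1) * m"
        using m0 dividend_less_times_div[of m e] by (auto simp: algebra_simps)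
      ultimately show ?thesis by (intro bexI[of _ e]) (simp_all add: block_def)
    qed
    then obtain f where f: "\<And>i. i \<in> J \<Longrightarrow> f i \<in> block i \<and> relabel \<phi> H ! f i = (hi i, lo i)"
      by metis
    then have "restrict f J \<in> PiE J block" "H \<in> A (restrict f J)" using H by (auto simp: A_def)
    then show "H \<in> (\<Union>f\<in>PiE J block. A f)" by blast
  qed
  have prob_A: "?P (A f) \<le> (\<Prod>i\<in>J. ?\<kappa>1 (hi i) (lo i))" if f: "f \<in> PiE J block" for f
  proof (cases "inj_on f J")
    case True
    define \<tau> where "\<tau> e = lo (inv_into J f e)" for e
    have \<tau>: "\<tau> (f i) = lo i" if "i \<in> J" for i using True that by (simp add: \<tau>_def)
    have fb: "f i div m + 1 = hi i" "2 * m \<le> f i" "f i < m * t" if "i \<in> J" for i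
      using block[OF that, of "f i"] f that by auto
    have "?P (A f) \<le> ?P {H. \<forall>e\<in>f ` J. snd (relabel \<phi> H ! e) = \<tau> e}"
      by (intro measure_pmf.finite_measure_mono) (auto simp: A_def \<tau>)
    also have "\<dots> \<le> (\<Prod>e\<in>f ` J. ?\<kappa>1 (e div m + 1) (\<tau> e))"
    proof (intro prob_positions_le N)
      show "f ` J \<subseteq> {2 * m..<m * t}" using fb by auto
      show "1 \<le> \<tau> e \<and> \<tau> e \<le> e div m" if e: "e \<in> f ` J" for e
      proof -
        obtain i where i: "i \<in> J" "e = f i" using e by blast
        then have "lo i < hi i" "1 \<le> lo i" using lohi[of i] by (auto simp: J_def)
        then show ?thesis using fb(1)[OF i(1)] \<tau>[OF i(1)] i(2) by simp
      qed
      show "card {e \<in> f ` J. \<tau> e = w} \<le> 2" for w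
      proof -
        have fin: "finite {i. Suc i < length xs \<and> (xs ! i = w \<or> xs ! Suc i = w)}"
          by (rule finite_subset[of _ "{..length xs}"]) auto
        have "{e \<in> f ` J. \<tau> e = w} \<subseteq> f ` {i. Suc i < length xs \<and> (xs ! i = w \<or> xs ! Suc i = w)}"
          by (auto simp: \<tau> J_def lo_def min_def split: if_splits)
        then have "card {e \<in> f ` J. \<tau> e = w}
            \<le> card {i. Suc i < length xs \<and> (xs ! i = w \<or> xs ! Suc i = w)}"
          by (rule surj_card_le[OF fin])
        also have "\<dots> \<le> 2" by (rule card_incident_pairs_le[OF xs(1)])
        finally show ?thesis .
      qed
    qed
    also have "\<dots> = (\<Prod>i\<in>J. ?\<kappa>1 (hi i) (lo i))"
      using fb(1) \<tau> by (subst prod.reindex[OF True]) (simp add: comp_def)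
    finally show ?thesis .
  next
    case False
    \<comment> \<open>Two steps would use the same edge of the graph although they join different
      pairs, so the event is empty.\<close>
    then obtain i j where ij: "i \<in> J" "j \<in> J" "f i = f j" "i \<noteq> j" by (auto simp: inj_on_def)
    have "(hi i, lo i) \<noteq> (hi j, lo j)"
      using consecutive_pair_inj[OF xs(1), of i j] ij by (auto simp: J_def hi_def lo_def)
    then have "A f = {}" using ij unfolding A_def by (metis (mono_tags, lifting) Collect_empty_eq)
    then show ?thesis using C by (auto intro!: prod_nonneg pa_kernel_nonneg)
  qed
  have finP: "finite (PiE J block)" using finJ by (intro finite_PiE) (auto simp: block_def)
  have "card (block i) = m" if "i \<in> J" for i
    using that by (cases "hi i") (auto simp: J_def block_def)
  then have cardP: "card (PiE J block) = m ^ card J" using finJ by (simp add: card_PiE)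
  have "?P ?E = ?P (?E \<inter> set_pmf (\<mu> (m * t)))" by (simp add: measure_Int_set_pmf)
  also have "\<dots> \<le> ?P (\<Union>f\<in>PiE J block. A f)" by (intro measure_pmf.finite_measure_mono cover) simp
  also have "\<dots> \<le> (\<Sum>f\<in>PiE J block. ?P (A f))"
    by (intro measure_pmf.finite_measure_subadditive_finite finP) auto
  also have "\<dots> \<le> (\<Sum>f\<in>PiE J block. \<Prod>i\<in>J. ?\<kappa>1 (hi i) (lo i))" by (intro sum_mono prob_A)
  also have "\<dots> = (\<Prod>i\<in>J. real m * ?\<kappa>1 (hi i) (lo i))" by (simp add: cardP prod.distrib)
  also have "\<dots> = (\<Prod>i\<in>J. ?\<kappa> (hi i) (lo i))" by (simp add: pa_kernel_def mult.assoc)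
  also have "\<dots> \<le> (\<Prod>i<length xs - 1. ?\<kappa> (hi i) (lo i))"
  proof (rule prod_mono2)
    show "J \<subseteq> {..<length xs - 1}" by (auto simp: J_def)
    show "0 \<le> ?\<kappa> (hi i) (lo i)" for i using C by (intro pa_kernel_nonneg) simp
    fix i assume "i \<in> {..<length xs - 1} - J"
    then have i: "Suc i < length xs" "hi i < 3" by (auto simp: J_def)
    then have [simp]: "hi i = 2" "lo i = 1" using lohi[OF i(1)] by auto
    \<comment> \<open>For the pair of vertices 1 and 2 the kernel is the constant times
      \<open>2 powr (\<gamma> - 1)\<close>, which is at least half the constant and hence at least
      1.\<close>
    have "1 * 2 \<le> real m * edge_const m \<delta>"
      using m edge_const_ge[OF m \<delta>] by (intro mult_mono) auto
    moreover have "2 powr (- 1) \<le> (2 :: real) powr (\<gamma> - 1)" using \<gamma> by (intro powr_mono) auto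
    ultimately have "2 * 2 powr (- 1) \<le> real m * edge_const m \<delta> * 2 powr (\<gamma> - 1)"
      by (intro mult_mono) auto
    then show "1 \<le> ?\<kappa> (hi i) (lo i)" by (simp add: pa_kernel_def powr_minus)
  qed auto
  also have "\<dots> = path_weight ?\<kappa> xs"
    unfolding path_weight_def
    by (intro prod.cong refl) (auto simp: hi_def lo_def pa_kernel_def max_def min_def)
  finally show ?thesis .
qed

end

section \<open>Distances\<close>

text \<open>Loop erasure: if the path found from the second vertex returns to \<open>a\<close>, the
  part before that return is dropped.\<close>

lemma relpow_distinct_path:
  assumes "(a, b) \<in> R ^^ n"
  shows "\<exists>xs. distinct xs \<and> xs \<noteq> [] \<and> hd xs = a \<and> last xs = b \<and> length xs \<le> Suc n \<and>
    successively (\<lambda>u v. (u, v) \<in> R) xs"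
  using assms
proof (induction n arbitrary: a)
  case 0
  then show ?case by (intro exI[of _ "[a]"]) auto
next
  case (Suc n)
  obtain y where y: "(a, y) \<in> R" "(y, b) \<in> R ^^ n" using relpow_Suc_D2[OF Suc.prems] by blast
  obtain ys where ys: "distinct ys" "ys \<noteq> []" "hd ys = y" "last ys = b" "length ys \<le> Suc n"
    "successively (\<lambda>u v. (u, v) \<in> R) ys" using Suc.IH[OF y(2)] by blast
  show ?case
  proof (cases "a \<in> set ys")
    case True
    then obtain p q where "ys = p @ a # q" by (meson split_list)
    then show ?thesis using ys by (intro exI[of _ "a # q"]) (auto simp: successively_append_iff)
  next
    case False
    then show ?thesis using ys y(1) by (intro exI[of _ "a # ys"]) (auto simp: successively_Cons)
  qed
qed

lemma graph_dist_less_imp_walk: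
  assumes "ereal_of_enat (graph_dist G a b) < ereal s"
  shows "\<exists>n\<le>nat \<lfloor>s\<rfloor>. (a, b) \<in> adj G ^^ n"
proof -
  obtain d where d: "graph_dist G a b = enat d" using assms by (cases "graph_dist G a b") auto
  then have "(INF n\<in>{n. (a, b) \<in> adj G ^^ n}. enat n) < enat (Suc d)" by (simp add: graph_dist_def)
  then obtain n where "(a, b) \<in> adj G ^^ n" "n \<le> d" unfolding INF_less_iff by auto
  moreover have "real d < s" using assms d by simp
  then have "d \<le> nat \<lfloor>s\<rfloor>" by (simp add: le_nat_floor)
  ultimately show ?thesis by (meson le_trans)
qed

section \<open>Random end points and the union bound over paths\<close>

lemma prob_bind_pmf_of_set:
  assumes "finite A" "A \<noteq> {}"
  shows "measure_pmf.prob (bind_pmf (pmf_of_set A) f) E = (\<Sum>a\<in>A. measure_pmf.prob (f a) E) / real (card A)"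
proof -
  have "0 < card A" using assms by (simp add: card_gt_0_iff)
  have "emeasure (measure_pmf (bind_pmf (pmf_of_set A) f)) E =
      (\<Sum>a\<in>A. ennreal (measure_pmf.prob (f a) E)) / ennreal (real (card A))"
    unfolding emeasure_bind_pmf nn_integral_pmf_of_set[OF assms(2,1)]
    by (simp add: measure_pmf.emeasure_eq_measure ennreal_of_nat_eq_real_of_nat)
  also have "\<dots> = ennreal ((\<Sum>a\<in>A. measure_pmf.prob (f a) E) / real (card A))"
    using \<open>0 < card A\<close> by (simp add: sum_ennreal divide_ennreal sum_nonneg)
  finally show ?thesis by (simp add: measure_pmf.emeasure_eq_measure sum_nonneg)
qed

lemma prob_pair_uniform:
  fixes P :: "'a pmf"
  assumes "1 \<le> t"
  defines "U \<equiv> pmf_of_set {1..t :: nat}"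
  shows "measure_pmf.prob (pair_pmf P (pair_pmf U U)) E =
    (\<Sum>a=1..t. \<Sum>b=1..t. measure_pmf.prob P {G. (G, a, b) \<in> E}) / (real t)\<^sup>2"
proof -
  have "pair_pmf P (pair_pmf U U) =
      bind_pmf P (\<lambda>G. bind_pmf U (\<lambda>a. bind_pmf U (\<lambda>b. return_pmf (G, a, b))))"
    by (simp add: pair_pmf_def bind_assoc_pmf bind_return_pmf)
  also have "\<dots> = bind_pmf U (\<lambda>a. bind_pmf P (\<lambda>G. bind_pmf U (\<lambda>b. return_pmf (G, a, b))))"
    by (rule bind_commute_pmf)
  also have "\<dots> = bind_pmf U (\<lambda>a. bind_pmf U (\<lambda>b. bind_pmf P (\<lambda>G. return_pmf (G, a, b))))"
    by (intro bind_pmf_cong refl bind_commute_pmf)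
  also have "\<dots> = bind_pmf U (\<lambda>a. bind_pmf U (\<lambda>b. map_pmf (\<lambda>G. (G, a, b)) P))"
    by (simp add: map_pmf_def)
  finally have "measure_pmf.prob (pair_pmf P (pair_pmf U U)) E =
      (\<Sum>a=1..t. (\<Sum>b=1..t. measure_pmf.prob (map_pmf (\<lambda>G. (G, a, b)) P) E) / real t) / real t"
    using assms by (simp add: prob_bind_pmf_of_set)
  also have "\<dots> = (\<Sum>a=1..t. \<Sum>b=1..t. measure_pmf.prob P {G. (G, a, b) \<in> E}) / (real t)\<^sup>2"
    by (simp add: sum_divide_distrib[symmetric] power2_eq_square vimage_def)
  finally show ?thesis .
qed

text \<open>The factor \<open>L\<close> per step: the constant of \<open>sum_pa_kernel_le\<close>
  for the kernel constant \<open>real m * edge_const m \<delta>\<close>.\<close>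

definition path_growth :: "nat \<Rightarrow> real \<Rightarrow> real" where
  "path_growth m \<delta> = 3 * (real m * edge_const m \<delta>) / (1 / 2 - attach_exponent m \<delta>)"

lemma path_growth_gt_1:
  assumes "1 \<le> m" "0 < \<delta>"
  shows "1 < path_growth m \<delta>"
proof -
  have "1 * 5 \<le> real m * edge_const m \<delta>"
    using assms edge_const_ge[OF assms] by (intro mult_mono) auto
  moreover have "0 \<le> attach_exponent m \<delta>" "attach_exponent m \<delta> < 1 / 2"
    using attach_exponent_bounds[OF assms] by auto
  ultimately show ?thesis by (simp add: path_growth_def less_divide_eq)
qed

context pa_chain
begin

lemma set_relabel:
  assumes "2 \<le> t" "H \<in> set_pmf (\<mu> (m * t))"
  shows "set (relabel \<phi> H) \<subseteq> {1..t} \<times> {1..t}"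
proof
  fix p assume "p \<in> set (relabel \<phi> H)"
  then obtain e where e: "e < length (relabel \<phi> H)" "p = relabel \<phi> H ! e"
    unfolding in_set_conv_nth by blast
  have *: "length H = m * t" "\<forall>e<m * t. relabel \<phi> H ! e \<in>
      (if e < 2 * m then {1..2} \<times> {1..2} else {e div m + 1} \<times> {1..e div m + 1})"
    using wf[OF _ assms(2)] assms(1) by auto
  then have "e < m * t" using e by simp
  then have "p \<in> (if e < 2 * m then {1..2} \<times> {1..2} else {e div m + 1} \<times> {1..e div m + 1})"
    using *(2) e(2) by blast
  moreover have "e div m + 1 \<le> t"
    using \<open>e < m * t\<close> m by (simp add: div_less_iff_less_mult mult.commute Suc_le_eq)
  ultimately show "p \<in> {1..t} \<times> {1..t}" using assms(1) by (cases p) (auto split: if_splits)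
qed

lemma prob_walk_le:
  assumes t: "2 \<le> t" and a: "a \<in> {1..t}"
  shows "measure_pmf.prob (\<mu> (m * t)) {H. \<exists>n\<le>k. (a, b) \<in> adj (relabel \<phi> H) ^^ n}
    \<le> (\<Sum>xs\<in>{xs \<in> (\<Union>j\<le>k. vertex_seqs t j a). last xs = b}.
        path_weight (pa_kernel (real m * edge_const m \<delta>) \<gamma>) xs)"
proof -
  let ?P = "measure_pmf.prob (\<mu> (m * t))"
  let ?w = "path_weight (pa_kernel (real m * edge_const m \<delta>) \<gamma>)"
  let ?E = "{H. \<exists>n\<le>k. (a, b) \<in> adj (relabel \<phi> H) ^^ n}"
  let ?Y = "{xs \<in> (\<Union>j\<le>k. vertex_seqs t j a). last xs = b}"
  \<comment> \<open>The path bound needs distinct vertices. The sum is enlarged to all sequences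
    only after the probabilities have been replaced by nonnegative weights.\<close>
  define X where "X = {xs \<in> ?Y. distinct xs}"
  define F where "F xs = {H. successively (\<lambda>u v. (u, v) \<in> adj (relabel \<phi> H)) xs}" for xs
  have Y: "finite ?Y" by (auto simp: finite_vertex_seqs)
  then have X: "finite X" by (rule rev_finite_subset) (auto simp: X_def)
  have "H \<in> (\<Union>xs\<in>X. F xs)" if E: "H \<in> ?E" and H: "H \<in> set_pmf (\<mu> (m * t))" for H
  proof -
    obtain n where n: "n \<le> k" "(a, b) \<in> adj (relabel \<phi> H) ^^ n" using E by blast
    obtain xs where xs: "distinct xs" "xs \<noteq> []" "hd xs = a" "last xs = b" "length xs \<le> Suc n"
      "successively (\<lambda>u v. (u, v) \<in> adj (relabel \<phi> H)) xs"
      using relpow_distinct_path[OF n(2)] by blast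
    have "xs ! i \<in> {1..t}" if i: "i < length xs" for i
    proof (cases i)
      case 0
      then show ?thesis using xs(2,3) a by (simp add: hd_conv_nth)
    next
      case (Suc j)
      then have "(xs ! j, xs ! i) \<in> adj (relabel \<phi> H)" using successively_nth[OF xs(6)] i by simp
      then show ?thesis using set_relabel[OF t H] by (auto simp: adj_def)
    qed
    then have "set xs \<subseteq> {1..t}" by (auto simp: in_set_conv_nth)
    moreover obtain j where "length xs = Suc j" using xs(2) by (cases xs) auto
    ultimately have "xs \<in> X" using xs n(1) by (auto simp: X_def vertex_seqs_def)
    then show ?thesis using xs(6) by (auto simp: F_def)
  qed
  then have cover: "?E \<inter> set_pmf (\<mu> (m * t)) \<subseteq> (\<Union>xs\<in>X. F xs)" by blast
  have C: "0 \<le> real m * edge_const m \<delta>" using edge_const_ge[OF m \<delta>] by simp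
  have "?P ?E = ?P (?E \<inter> set_pmf (\<mu> (m * t)))" by (simp add: measure_Int_set_pmf)
  also have "\<dots> \<le> ?P (\<Union>xs\<in>X. F xs)" by (intro measure_pmf.finite_measure_mono cover) simp
  also have "\<dots> \<le> (\<Sum>xs\<in>X. ?P (F xs))"
    by (intro measure_pmf.finite_measure_subadditive_finite X) auto
  also have "\<dots> \<le> (\<Sum>xs\<in>X. ?w xs)"
    unfolding F_def by (intro sum_mono prob_path_le t) (auto simp: X_def vertex_seqs_def)
  also have "\<dots> \<le> (\<Sum>xs\<in>?Y. ?w xs)"
    using Y C by (intro sum_mono2) (auto simp: X_def path_weight_def intro!: prod_nonneg pa_kernel_nonneg)
  finally show ?thesis .
qed

lemma sum_prob_walk_le:
  assumes t: "2 \<le> t"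
  shows "(\<Sum>a=1..t. \<Sum>b=1..t.
      measure_pmf.prob (\<mu> (m * t)) {H. \<exists>n\<le>k. (a, b) \<in> adj (relabel \<phi> H) ^^ n})
    \<le> 4 * real (Suc k) * path_growth m \<delta> ^ k * real t"
proof -
  let ?P = "measure_pmf.prob (\<mu> (m * t))" and ?L = "path_growth m \<delta>"
  let ?w = "path_weight (pa_kernel (real m * edge_const m \<delta>) \<gamma>)"
  let ?V = "\<lambda>a. \<Union>j\<le>k. vertex_seqs t j a"
  have C: "0 \<le> real m * edge_const m \<delta>" using edge_const_ge[OF m \<delta>] by simp
  have L: "1 \<le> ?L" using path_growth_gt_1[OF m \<delta>] by simp
  have finV: "finite (?V a)" for a by (auto simp: finite_vertex_seqs)
  have "(\<Sum>b=1..t. ?P {H. \<exists>n\<le>k. (a, b) \<in> adj (relabel \<phi> H) ^^ n})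
      \<le> (\<Sum>j\<le>k. \<Sum>xs\<in>vertex_seqs t j a. ?w xs)" if a: "a \<in> {1..t}" for a
  proof -
    have "(\<Sum>b=1..t. ?P {H. \<exists>n\<le>k. (a, b) \<in> adj (relabel \<phi> H) ^^ n})
        \<le> (\<Sum>b=1..t. \<Sum>xs\<in>{xs \<in> ?V a. last xs = b}. ?w xs)"
      by (intro sum_mono prob_walk_le t a)
    also have "\<dots> = (\<Sum>xs\<in>?V a. ?w xs)"
    proof (rule sum.group)
      show "last ` ?V a \<subseteq> {1..t}"
      proof
        fix b assume "b \<in> last ` ?V a"
        then obtain xs j where b: "b = last xs" and xs: "xs \<in> vertex_seqs t j a" by blast
        then have "xs \<noteq> []" "set xs \<subseteq> {1..t}" by (auto simp: vertex_seqs_def)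
        with b show "b \<in> {1..t}" using last_in_set[of xs] by blast
      qed
    qed (use finV in auto)
    also have "\<dots> = (\<Sum>j\<le>k. \<Sum>xs\<in>vertex_seqs t j a. ?w xs)"
      by (intro sum.UNION_disjoint ballI finite_vertex_seqs) (auto simp: vertex_seqs_def)
    finally show ?thesis .
  qed
  then have "(\<Sum>a=1..t. \<Sum>b=1..t. ?P {H. \<exists>n\<le>k. (a, b) \<in> adj (relabel \<phi> H) ^^ n})
      \<le> (\<Sum>a=1..t. \<Sum>j\<le>k. \<Sum>xs\<in>vertex_seqs t j a. ?w xs)" by (intro sum_mono)
  also have "\<dots> = (\<Sum>j\<le>k. \<Sum>a=1..t. \<Sum>xs\<in>vertex_seqs t j a. ?w xs)" by (rule sum.swap)
  also have "\<dots> \<le> (\<Sum>j\<le>k. 4 * ?L ^ j * real t)"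
    unfolding path_growth_def by (intro sum_mono sum_path_weight_pa_kernel_le C \<gamma>)
  \<comment> \<open>As \<open>L > 1\<close>, the longest paths dominate; the \<open>k + 1\<close>
    possible lengths cost only a logarithmic factor in the end.\<close>
  also have "\<dots> \<le> (\<Sum>j\<le>k. 4 * ?L ^ k * real t)"
    using L by (intro sum_mono mult_right_mono mult_left_mono power_increasing) auto
  also have "\<dots> = 4 * real (Suc k) * ?L ^ k * real t" by simp
  finally show ?thesis .
qed

text \<open>The bound on \<open>c2\<close> gives \<open>L ^ k \<le> t powr (1 / 2)\<close>, so the
  expected number of close pairs is at most \<open>4 * (k + 1) * t powr (3 / 2)\<close>, out of
  \<open>t\<^sup>2\<close> pairs.\<close>

lemma prob_far_ge:
  assumes t: "2 \<le> t" and c2: "0 < c2" "c2 \<le> 1 / (2 * ln (path_growth m \<delta>))"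
  defines "U \<equiv> pmf_of_set {1..t}"
  shows "1 - 4 * (c2 * ln (real t) + 1) * real t powr (- 1 / 2) \<le>
    measure_pmf.prob (pair_pmf (map_pmf (relabel \<phi>) (\<mu> (m * t))) (pair_pmf U U))
      {(G, A1, A2). ereal_of_enat (graph_dist G A1 A2) \<ge> ereal (c2 * ln (real t))}"
proof -
  let ?Q = "measure_pmf.prob (pair_pmf (map_pmf (relabel \<phi>) (\<mu> (m * t))) (pair_pmf U U))"
  let ?F = "{(G, A1, A2). ereal_of_enat (graph_dist G A1 A2) \<ge> ereal (c2 * ln (real t))}"
  let ?L = "path_growth m \<delta>"
  define s where "s = c2 * ln (real t)"
  define k where "k = nat \<lfloor>s\<rfloor>"
  let ?B = "{(G, a, b). \<exists>n\<le>k. (a, b) \<in> adj G ^^ n}"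
  have s: "0 \<le> s" using t c2 by (simp add: s_def)
  then have k: "real k \<le> s" by (simp add: k_def)
  have L: "1 < ?L" by (rule path_growth_gt_1[OF m \<delta>])
  have "- ?F \<subseteq> ?B"
  proof
    fix x assume "x \<in> - ?F"
    then obtain G a b where x: "x = (G, a, b)" "ereal_of_enat (graph_dist G a b) < ereal s"
      by (cases x) (auto simp: s_def)
    then show "x \<in> ?B" using graph_dist_less_imp_walk[OF x(2)] by (simp add: k_def)
  qed
  then have "?Q (- ?F) \<le> ?Q ?B" by (intro measure_pmf.finite_measure_mono) auto
  also have "?Q ?B = (\<Sum>a=1..t. \<Sum>b=1..t.
      measure_pmf.prob (\<mu> (m * t)) {H. \<exists>n\<le>k. (a, b) \<in> adj (relabel \<phi> H) ^^ n}) / (real t)\<^sup>2"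
    unfolding U_def using t by (subst prob_pair_uniform) (auto simp: vimage_def)
  also have "\<dots> \<le> (4 * real (Suc k) * ?L ^ k * real t) / (real t)\<^sup>2"
    by (intro divide_right_mono sum_prob_walk_le t) simp
  also have "\<dots> = 4 * (real k + 1) * ?L ^ k / real t"
    using t by (simp add: power2_eq_square add.commute)
  also have "\<dots> \<le> 4 * (s + 1) * real t powr (1 / 2) / real t"
  proof (intro divide_right_mono mult_mono)
    have "?L ^ k = ?L powr real k" using L by (simp add: powr_realpow)
    also have "\<dots> \<le> ?L powr s" using L k by (intro powr_mono) auto
    also have "\<dots> = real t powr (c2 * ln ?L)" using L t by (simp add: powr_def s_def mult_ac)
    also have "\<dots> \<le> real t powr (1 / 2)"
    proof (rule powr_mono)
      have "c2 * ln ?L \<le> 1 / (2 * ln ?L) * ln ?L" using L c2 by (intro mult_right_mono) auto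
      also have "\<dots> = 1 / 2" using L by simp
      finally show "c2 * ln ?L \<le> 1 / 2" .
    qed (use t in simp)
    finally show "?L ^ k \<le> real t powr (1 / 2)" .
  qed (use k s L in auto)
  also have "\<dots> = 4 * (s + 1) * real t powr (- 1 / 2)"
  proof -
    have "real t powr (- 1 / 2) = real t powr (1 / 2 - 1)" by simp
    also have "\<dots> = real t powr (1 / 2) / real t powr 1" by (rule powr_diff)
    finally show ?thesis using t by simp
  qed
  finally have "?Q (- ?F) \<le> 4 * (s + 1) * real t powr (- 1 / 2)" .
  moreover have "?Q (- ?F) = 1 - ?Q ?F"
    using measure_pmf.prob_compl[of ?F "pair_pmf (map_pmf (relabel \<phi>) (\<mu> (m * t))) (pair_pmf U U)"]
    by (simp add: Compl_eq_Diff_UNIV)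
  ultimately show ?thesis by (simp add: s_def)
qed

end

section \<open>The three models\<close>

definition merge_label :: "nat \<Rightarrow> nat \<Rightarrow> nat" where
  "merge_label m v = (v - 1) div m + 1"

lemma merge_vertices_eq_relabel: "merge_vertices m = relabel (merge_label m)"
  by (simp add: fun_eq_iff merge_vertices_def merge_label_def[abs_def])

text \<open>Positivity of \<open>v\<close> matters: truncated subtraction sends 0 to the label 1 as
  well.\<close>

lemma merge_label_eq_iff:
  assumes "1 \<le> m" "1 \<le> u" "1 \<le> v"
  shows "merge_label m v = u \<longleftrightarrow> v \<in> {(u - 1) * m + 1..u * m}"
proof -
  obtain u' v' where [simp]: "u = Suc u'" "v = Suc v'" using assms by (metis Suc_le_D One_nat_def)
  have "v' div m = u' \<longleftrightarrow> u' * m \<le> v' \<and> v' < Suc u' * m"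
    using assms(1) div_nat_eqI[of m u' v'] dividend_less_times_div[of m v']
    by (auto simp: mult.commute)
  then show ?thesis by (auto simp: merge_label_def)
qed

text \<open>The \<open>m\<close> vertices merged into \<open>u\<close> carry
  \<open>\<delta> / m\<close> each, which adds up to \<open>\<delta>\<close>, and their degrees add
  up to at most the merged degree. Rounding \<open>n\<close> down to a multiple of \<open>m\<close>
  only decreases the denominator.\<close>

lemma pmf_merge_label_le:
  fixes \<delta> :: real
  assumes m: "1 \<le> m" and \<delta>: "0 < \<delta>" and n: "2 * m \<le> n" and u: "u \<le> n div m"
    and K: "\<And>i. i \<in> {1..n} \<Longrightarrow>
      pmf K i \<le> (real (vertex_degree H i) + \<delta> / real m) / (real n * (2 + \<delta> / real m))"
    and supp: "\<And>i. i \<in> set_pmf K \<Longrightarrow> 1 \<le> i"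
  shows "pmf (map_pmf (merge_label m) K) u
    \<le> (real (vertex_degree (relabel (merge_label m) H) u) + \<delta>) / (real (n div m) * (2 * real m + \<delta>))"
proof (cases "u = 0")
  case True
  then have "merge_label m -` {u} = {}" by (auto simp: merge_label_def)
  then show ?thesis using \<delta> by (simp add: pmf_map)
next
  case False
  let ?A = "{(u - 1) * m + 1..u * m}" and ?d = "vertex_degree (relabel (merge_label m) H) u"
  have "u * m \<le> (n div m) * m" using u by simp
  also have "\<dots> \<le> n" by simp
  finally have A: "?A \<subseteq> {1..n}" by auto
  have card: "card ?A = m" using False by (cases u) auto
  have merge: "merge_label m i = u \<longleftrightarrow> i \<in> ?A" if "1 \<le> i" for i
    using merge_label_eq_iff[OF m _ that, of u] False by simp
  have n0: "0 < real n * (2 + \<delta> / real m)" using m n \<delta> by (intro mult_pos_pos add_pos_nonneg) auto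
  have "pmf (map_pmf (merge_label m) K) u = measure_pmf.prob K (merge_label m -` {u} \<inter> set_pmf K)"
    by (simp add: pmf_map measure_Int_set_pmf)
  also have "\<dots> \<le> measure_pmf.prob K ?A"
  proof (rule measure_pmf.finite_measure_mono)
    show "merge_label m -` {u} \<inter> set_pmf K \<subseteq> ?A"
      by (intro subsetI) (metis IntD1 IntD2 merge supp vimage_singleton_eq)
  qed simp
  also have "\<dots> = (\<Sum>i\<in>?A. pmf K i)" by (simp add: measure_measure_pmf_finite)
  also have "\<dots> \<le> (\<Sum>i\<in>?A. (real (vertex_degree H i) + \<delta> / real m) / (real n * (2 + \<delta> / real m)))"
    using A by (intro sum_mono K) auto
  also have "\<dots> = (real (\<Sum>i\<in>?A. vertex_degree H i) + \<delta>) / (real n * (2 + \<delta> / real m))"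
    unfolding sum_divide_distrib[symmetric] sum.distrib sum_constant card using m by simp
  also have "\<dots> \<le> (real ?d + \<delta>) / (real n * (2 + \<delta> / real m))"
  proof (intro divide_right_mono add_right_mono)
    have "(\<Sum>i\<in>?A. vertex_degree H i) \<le> ?d"
      using merge by (intro sum_vertex_degree_le_relabel) auto
    then show "real (\<Sum>i\<in>?A. vertex_degree H i) \<le> real ?d" by (rule of_nat_mono)
  qed (use n0 in simp)
  also have "\<dots> \<le> (real ?d + \<delta>) / (real (n div m) * (2 * real m + \<delta>))"
  proof (rule divide_left_mono)
    have "real (n div m) * (2 * real m + \<delta>) = real (n div m * m) * (2 + \<delta> / real m)"
      using m by (simp add: field_simps)
    also have "\<dots> \<le> real n * (2 + \<delta> / real m)"
      using \<delta> by (intro mult_right_mono of_nat_mono) auto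
    finally show "real (n div m) * (2 * real m + \<delta>) \<le> real n * (2 + \<delta> / real m)" .
    have "0 < n div m" using False u by simp
    then have "0 < real (n div m) * (2 * real m + \<delta>)"
      using \<delta> by (intro mult_pos_pos add_nonneg_pos) auto
    then show "0 < real n * (2 + \<delta> / real m) * (real (n div m) * (2 * real m + \<delta>))"
      by (rule mult_pos_pos[OF n0])
  qed (use \<delta> in simp)
  finally show ?thesis .
qed

lemma merge_label_mem:
  assumes "1 \<le> m" "1 \<le> i" "i \<le> n + 1"
  shows "merge_label m i \<in> {1..n div m + 1}"
proof -
  have "(i - 1) div m \<le> n div m" using assms by (intro div_le_mono) simp
  then show ?thesis by (simp add: merge_label_def)
qed

lemma relabel_merge_initial:
  assumes "1 \<le> m" "set H \<subseteq> {1..2 * m} \<times> {1..2 * m}"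
  shows "set (relabel (merge_label m) H) \<subseteq> {1..2} \<times> {1..2}"
proof -
  have "merge_label m i \<in> {1..2}" if "i \<in> {1..2 * m}" for i
    using merge_label_mem[OF assms(1), of i "2 * m - 1"] that assms(1)
    by (auto simp: div_nat_eqI merge_label_def less_Suc_eq_le[symmetric] div_less_iff_less_mult)
  then show ?thesis using assms(2) by fastforce
qed

text \<open>Self-loops and edges into the unfinished block get the label \<open>n div m + 1\<close>,
  at which the chain asks for no attachment bound. At older vertices, leaving out the self-loop term
  \<open>1 + \<delta> / m\<close> of the denominator only enlarges the bound.\<close>

lemma pa_chain_a:
  assumes m: "1 \<le> m" and \<delta>: "0 < \<delta>"
  shows "pa_chain m \<delta> (merge_label m) Suc (attach_a (\<delta> / real m)) (graph_a1 (\<delta> / real m))"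
proof
  let ?\<delta> = "\<delta> / real m"
  have \<delta>': "0 < ?\<delta>" using m \<delta> by simp
  show "m \<ge> 1" "\<delta> > 0" by fact+
  show "graph_a1 ?\<delta> (Suc n) = bind_pmf (graph_a1 ?\<delta> n) (\<lambda>H. map_pmf (\<lambda>i. H @ [(Suc n, i)]) (attach_a ?\<delta> n H))"
    if "2 * m \<le> n" for n
    using that m by (cases n) (auto simp: Let_def)
  show "merge_label m (Suc n) = n div m + 1" for n by (simp add: merge_label_def)
  show "length H = 2 * m \<and> set (relabel (merge_label m) H) \<subseteq> {1..2} \<times> {1..2}"
    if "H \<in> set_pmf (graph_a1 ?\<delta> (2 * m))" for H
    using graph_a1_wf[OF \<delta>' that] relabel_merge_initial[OF m] by blast
  have supp: "i \<in> {1..n + 1}" if "2 * m \<le> n" "H \<in> set_pmf (graph_a1 ?\<delta> n)" "i \<in> set_pmf (attach_a ?\<delta> n H)" for n H i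
    using that(3) graph_a1_wf[OF \<delta>' that(2)] by (simp add: set_pmf_iff pmf_attach_a[OF \<delta>'] split: if_splits)
  then show "merge_label m i \<in> {1..n div m + 1}"
    if "2 * m \<le> n" "H \<in> set_pmf (graph_a1 ?\<delta> n)" "i \<in> set_pmf (attach_a ?\<delta> n H)" for n H i
    using merge_label_mem[OF m] that by (meson atLeastAtMost_iff)
  show "pmf (map_pmf (merge_label m) (attach_a ?\<delta> n H)) u
      \<le> (real (vertex_degree (relabel (merge_label m) H) u) + \<delta>) / (real (n div m) * (2 * real m + \<delta>))"
    if n: "2 * m \<le> n" and H: "H \<in> set_pmf (graph_a1 ?\<delta> n)" and u: "u \<le> n div m" for n H u
  proof (rule pmf_merge_label_le[OF m \<delta> n u])
    show "1 \<le> i" if "i \<in> set_pmf (attach_a ?\<delta> n H)" for i using supp[OF n H that] by simp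
    fix i assume i: "i \<in> {1..n}"
    then have "pmf (attach_a ?\<delta> n H) i =
        (real (vertex_degree H i) + ?\<delta>) / (real n * (2 + ?\<delta>) + (1 + ?\<delta>))"
      using graph_a1_wf[OF \<delta>' H] by (simp add: pmf_attach_a[OF \<delta>'])
    also have "\<dots> \<le> (real (vertex_degree H i) + ?\<delta>) / (real n * (2 + ?\<delta>))"
      using \<delta>' i by (intro divide_left_mono mult_pos_pos add_pos_pos) auto
    finally show "pmf (attach_a ?\<delta> n H) i \<le> (real (vertex_degree H i) + ?\<delta>) / (real n * (2 + ?\<delta>))" .
  qed
qed

lemma pa_chain_b:
  assumes m: "1 \<le> m" and \<delta>: "0 < \<delta>"
  shows "pa_chain m \<delta> (merge_label m) Suc (attach 1 (\<delta> / real m)) (graph_b1 (\<delta> / real m))"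
proof
  let ?\<delta> = "\<delta> / real m"
  have \<delta>': "0 < ?\<delta>" using m \<delta> by simp
  show "m \<ge> 1" "\<delta> > 0" by fact+
  show "graph_b1 ?\<delta> (Suc n) = bind_pmf (graph_b1 ?\<delta> n) (\<lambda>H. map_pmf (\<lambda>i. H @ [(Suc n, i)]) (attach 1 ?\<delta> n H))"
    if n: "2 * m \<le> n" for n
  proof -
    have "n = Suc (Suc (n - 2))" using n m by simp
    then obtain k where "n = Suc (Suc k)" by blast
    then show ?thesis by (simp add: Let_def)
  qed
  show "merge_label m (Suc n) = n div m + 1" for n by (simp add: merge_label_def)
  have wf: "set H \<subseteq> {1..n} \<times> {1..n}" "length H = n" "1 \<le> n"
    if "2 * m \<le> n" "H \<in> set_pmf (graph_b1 ?\<delta> n)" for n H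
    using graph_b1_wf[OF \<delta>' _ that(2)] that(1) m by auto
  show "length H = 2 * m \<and> set (relabel (merge_label m) H) \<subseteq> {1..2} \<times> {1..2}"
    if "H \<in> set_pmf (graph_b1 ?\<delta> (2 * m))" for H
    using wf[OF order_refl that] relabel_merge_initial[OF m] by blast
  have pmf: "pmf (attach 1 ?\<delta> n H) i =
      (if i \<in> {1..n} then (real (vertex_degree H i) + ?\<delta>) / (real n * (2 * real 1 + ?\<delta>)) else 0)"
    if "2 * m \<le> n" "H \<in> set_pmf (graph_b1 ?\<delta> n)" for n H i
    using wf[OF that] \<delta>' by (intro pmf_attach) auto
  have supp: "i \<in> {1..n}" if "2 * m \<le> n" "H \<in> set_pmf (graph_b1 ?\<delta> n)" "i \<in> set_pmf (attach 1 ?\<delta> n H)" for n H i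
    using that(3) pmf[OF that(1,2)] by (metis pmf_eq_0_set_pmf)
  then show "merge_label m i \<in> {1..n div m + 1}"
    if "2 * m \<le> n" "H \<in> set_pmf (graph_b1 ?\<delta> n)" "i \<in> set_pmf (attach 1 ?\<delta> n H)" for n H i
    using merge_label_mem[OF m, of i n] supp[OF that] by simp
  show "pmf (map_pmf (merge_label m) (attach 1 ?\<delta> n H)) u
      \<le> (real (vertex_degree (relabel (merge_label m) H) u) + \<delta>) / (real (n div m) * (2 * real m + \<delta>))"
    if n: "2 * m \<le> n" and H: "H \<in> set_pmf (graph_b1 ?\<delta> n)" and u: "u \<le> n div m" for n H u
    using pmf[OF n H] supp[OF n H] by (intro pmf_merge_label_le[OF m \<delta> n u]) auto
qed

text \<open>Model (c), one edge at a time. The \<open>m\<close> edges of a vertex see the graph before its arrival,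
  which consists of the first \<open>m * T\<close> edges.\<close>

primrec chain_c :: "nat \<Rightarrow> real \<Rightarrow> nat \<Rightarrow> multigraph pmf" where
  "chain_c m \<delta> 0 = return_pmf (replicate (2 * m) (2, 1))"
| "chain_c m \<delta> (Suc k) = (let T = (2 * m + k) div m in
     bind_pmf (chain_c m \<delta> k) (\<lambda>H. map_pmf (\<lambda>i. H @ [(T + 1, i)]) (attach m \<delta> T (take (m * T) H))))"

text \<open>The edges of the new vertex are appended behind the first \<open>m * T\<close> ones, so
  every step of the block samples from the same law, independently given the old graph.\<close>

lemma graph_c_eq_chain_c:
  assumes m: "1 \<le> m" and \<delta>: "0 < \<delta>"
  shows "graph_c m \<delta> (Suc (Suc n)) = chain_c m \<delta> (m * n)"
proof (induction n)
  case (Suc n)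
  let ?T = "Suc (Suc n)"
  let ?p = "\<lambda>G. attach m \<delta> ?T G"
  have len: "length G = m * ?T" if "G \<in> set_pmf (chain_c m \<delta> (m * n))" for G
    using graph_c_wf[OF m \<delta>, of ?T G] that Suc.IH by simp
  \<comment> \<open>The induction runs over the partially built block, with \<open>j\<close> of its
    \<open>m\<close> edges present. The length of \<open>G\<close> is what makes \<open>take\<close>
    recover \<open>G\<close> itself.\<close>
  have "chain_c m \<delta> (m * n + j) = bind_pmf (chain_c m \<delta> (m * n)) (\<lambda>G.
      map_pmf (\<lambda>xs. G @ map (\<lambda>i. (?T + 1, i)) xs) (replicate_pmf j (?p G)))" if "j \<le> m" for j
    using that
  proof (induction j)
    case 0
    then show ?case by (simp add: bind_return_pmf')
  next
    case (Suc j)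
    have T: "(2 * m + (m * n + j)) div m = ?T"
      using Suc.prems by (intro div_nat_eqI) auto
    have "chain_c m \<delta> (m * n + Suc j) = bind_pmf (chain_c m \<delta> (m * n + j)) (\<lambda>H.
        map_pmf (\<lambda>i. H @ [(?T + 1, i)]) (?p (take (m * ?T) H)))"
      by (simp only: add_Suc_right chain_c.simps T Let_def)
    also have "\<dots> = bind_pmf (chain_c m \<delta> (m * n)) (\<lambda>G. bind_pmf (replicate_pmf j (?p G)) (\<lambda>xs.
        map_pmf (\<lambda>i. (G @ map (\<lambda>i. (?T + 1, i)) xs) @ [(?T + 1, i)])
          (?p (take (m * ?T) (G @ map (\<lambda>i. (?T + 1, i)) xs)))))"
      using Suc by (simp add: bind_assoc_pmf bind_map_pmf)
    also have "\<dots> = bind_pmf (chain_c m \<delta> (m * n)) (\<lambda>G. bind_pmf (replicate_pmf j (?p G)) (\<lambda>xs.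
        map_pmf (\<lambda>i. G @ map (\<lambda>i. (?T + 1, i)) (xs @ [i])) (?p G)))"
      by (intro bind_pmf_cong refl) (simp add: len)
    also have "\<dots> = bind_pmf (chain_c m \<delta> (m * n)) (\<lambda>G.
        map_pmf (\<lambda>xs. G @ map (\<lambda>i. (?T + 1, i)) xs) (replicate_pmf (j + 1) (?p G)))"
      unfolding replicate_pmf_distrib
      by (simp add: map_bind_pmf replicate_pmf_1 bind_map_pmf map_pmf_def bind_assoc_pmf bind_return_pmf)
    finally show ?case by simp
  qed
  from this[of m] show ?case
    by (simp add: Suc.IH Let_def add.commute)
qed simp

text \<open>The \<open>max 2\<close> is for the initial edges: those at positions below
  \<open>m\<close> would have \<open>e div m + 1 = 1\<close> although they join 1 and 2.\<close>

lemma take_block: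
  assumes m: "1 \<le> m" and "length H = n" and T: "2 \<le> T" "m * T \<le> n"
    and H: "\<And>e. e < n \<Longrightarrow> H ! e \<in> {1..max 2 (e div m + 1)} \<times> {1..max 2 (e div m + 1)}"
  shows "set (take (m * T) H) \<subseteq> {1..T} \<times> {1..T}" "length (take (m * T) H) = m * T"
proof -
  show "set (take (m * T) H) \<subseteq> {1..T} \<times> {1..T}"
  proof
    fix p assume "p \<in> set (take (m * T) H)"
    then obtain e where e: "e < m * T" "p = H ! e" by (auto simp: in_set_conv_nth)
    have "e div m < T" using e(1) m by (simp add: div_less_iff_less_mult mult.commute)
    then have "max 2 (e div m + 1) \<le> T" using T by simp
    moreover have "p \<in> {1..max 2 (e div m + 1)} \<times> {1..max 2 (e div m + 1)}"
      using H[of e] e T(2) by simp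
    ultimately show "p \<in> {1..T} \<times> {1..T}" by (cases p) auto
  qed
  show "length (take (m * T) H) = m * T" using assms(2) T(2) by simp
qed

lemma chain_c_wf:
  assumes m: "1 \<le> m" and \<delta>: "0 < \<delta>" and "H \<in> set_pmf (chain_c m \<delta> k)"
  shows "length H = 2 * m + k \<and>
    (\<forall>e<2 * m + k. H ! e \<in> {1..max 2 (e div m + 1)} \<times> {1..max 2 (e div m + 1)})"
  using assms(3)
proof (induction k arbitrary: H)
  case 0
  then show ?case by simp
next
  case (Suc k)
  define T where "T = (2 * m + k) div m"
  have T: "2 \<le> T" "m * T \<le> 2 * m + k" using m by (auto simp: T_def less_eq_div_iff_mult_less_eq)
  obtain G i where G: "G \<in> set_pmf (chain_c m \<delta> k)"
    and i: "i \<in> set_pmf (attach m \<delta> T (take (m * T) G))" and H: "H = G @ [(T + 1, i)]"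
    using Suc.prems by (auto simp: Let_def T_def)
  have wfG: "length G = 2 * m + k"
    "\<And>e. e < 2 * m + k \<Longrightarrow> G ! e \<in> {1..max 2 (e div m + 1)} \<times> {1..max 2 (e div m + 1)}"
    using Suc.IH[OF G] by auto
  have "pmf (attach m \<delta> T (take (m * T) G)) i = 0" if "i \<notin> {1..T}"
    using that T(1) by (subst pmf_attach[OF m \<delta> _ take_block[OF m wfG(1) T wfG(2)]]) auto
  then have "i \<in> {1..T}" using i by (auto simp: set_pmf_iff)
  then have new: "(T + 1, i) \<in> {1..max 2 (T + 1)} \<times> {1..max 2 (T + 1)}" by auto
  show ?case
  proof (intro conjI allI impI)
    fix e assume "e < 2 * m + Suc k"
    then consider "e < 2 * m + k" | "e = 2 * m + k" by linarith
    then show "H ! e \<in> {1..max 2 (e div m + 1)} \<times> {1..max 2 (e div m + 1)}"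
    proof cases
      case 1
      then show ?thesis using wfG by (simp only: H nth_append) simp
    next
      case 2
      then have "H ! e = (T + 1, i)" using wfG(1) by (simp add: H nth_append)
      then show ?thesis using new 2 by (simp add: T_def)
    qed
  qed (simp add: H wfG)
qed

lemma vertex_degree_take_le: "vertex_degree (take k G) v \<le> vertex_degree G v"
  using vertex_degree_append[of "take k G" "drop k G" v] by simp

lemma pa_chain_c:
  assumes m: "1 \<le> m" and \<delta>: "0 < \<delta>"
  shows "pa_chain m \<delta> (\<lambda>v. v) (\<lambda>n. n div m + 1) (\<lambda>n H. attach m \<delta> (n div m) (take (m * (n div m)) H))
    (\<lambda>n. chain_c m \<delta> (n - 2 * m))"
proof
  let ?K = "\<lambda>n H. attach m \<delta> (n div m) (take (m * (n div m)) H)"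
  show "m \<ge> 1" "\<delta> > 0" by fact+
  show "chain_c m \<delta> (Suc n - 2 * m) = bind_pmf (chain_c m \<delta> (n - 2 * m))
      (\<lambda>H. map_pmf (\<lambda>i. H @ [(n div m + 1, i)]) (?K n H))" if "2 * m \<le> n" for n
    using that by (simp add: Suc_diff_le Let_def)
  show "length H = 2 * m \<and> set (relabel (\<lambda>v. v) H) \<subseteq> {1..2} \<times> {1..2}"
    if "H \<in> set_pmf (chain_c m \<delta> (2 * m - 2 * m))" for H
    using that by (auto simp: map_prod_def)
  have pmf: "pmf (?K n H) i = (if i \<in> {1..n div m}
      then (real (vertex_degree (take (m * (n div m)) H) i) + \<delta>) / (real (n div m) * (2 * real m + \<delta>)) else 0)"
    if n: "2 * m \<le> n" and H: "H \<in> set_pmf (chain_c m \<delta> (n - 2 * m))" for n H i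
  proof -
    have T: "2 \<le> n div m" "m * (n div m) \<le> n" using m n by (auto simp: less_eq_div_iff_mult_less_eq)
    have wfH: "length H = n"
      "\<And>e. e < n \<Longrightarrow> H ! e \<in> {1..max 2 (e div m + 1)} \<times> {1..max 2 (e div m + 1)}"
      using chain_c_wf[OF m \<delta> H] n by auto
    show ?thesis
      using T(1) by (intro pmf_attach m \<delta> take_block[OF m wfH(1) T wfH(2)]) auto
  qed
  show "i \<in> {1..n div m + 1}"
    if "2 * m \<le> n" "H \<in> set_pmf (chain_c m \<delta> (n - 2 * m))" "i \<in> set_pmf (?K n H)" for n H i
    using that(3) pmf[OF that(1,2), of i] by (auto simp: set_pmf_iff split: if_splits)
  show "pmf (map_pmf (\<lambda>v. v) (?K n H)) u
      \<le> (real (vertex_degree (relabel (\<lambda>v. v) H) u) + \<delta>) / (real (n div m) * (2 * real m + \<delta>))"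
    if "2 * m \<le> n" "H \<in> set_pmf (chain_c m \<delta> (n - 2 * m))" "u \<le> n div m" for n H u
    using pmf[OF that(1,2), of u] \<delta> vertex_degree_take_le[of "m * (n div m)" H u]
    by (auto simp: map_prod_def intro!: divide_right_mono)
qed simp

lemma pa_graph_chain:
  assumes m: "1 \<le> m" and \<delta>: "0 < \<delta>"
  obtains \<phi> c K \<mu> where "pa_chain m \<delta> \<phi> c K \<mu>"
    "\<And>t. 2 \<le> t \<Longrightarrow> pa_graph M m \<delta> t = map_pmf (relabel \<phi>) (\<mu> (m * t))"
proof (cases M)
  case Model_a
  then show ?thesis using that[OF pa_chain_a[OF assms]] by (simp add: merge_vertices_eq_relabel)
next
  case Model_b
  then show ?thesis using that[OF pa_chain_b[OF assms]] by (simp add: merge_vertices_eq_relabel)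
next
  case Model_c
  have "pa_graph M m \<delta> t = map_pmf (relabel (\<lambda>v. v)) (chain_c m \<delta> (m * t - 2 * m))" if t: "2 \<le> t" for t
  proof -
    have "t = Suc (Suc (t - 2))" using t by simp
    then obtain n where "t = Suc (Suc n)" by blast
    then show ?thesis using graph_c_eq_chain_c[OF assms, of n] Model_c
      by (simp add: map_prod_def map_pmf_def bind_return_pmf')
  qed
  then show ?thesis using that[OF pa_chain_c[OF assms]] by blast
qed

theorem lemma2p5:
  fixes m :: nat and \<delta> :: real
  assumes "m \<ge> 1" and "\<delta> > 0"
  shows "\<exists>c0>0. \<forall>c2::real. 0 < c2 \<and> c2 \<le> c0 \<longrightarrow>
           (\<forall>M. (\<lambda>t. measure_pmf.prob (pa_sample M m \<delta> t)
                  {(G, A1, A2). ereal_of_enat (graph_dist G A1 A2) \<ge> ereal (c2 * ln (real t))})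
                \<longlonglongrightarrow> 1)"
\<comment> \<open>This threshold turns \<open>path_growth m \<delta>\<close> to the power
  \<open>c2 * ln t\<close> into at most the square root of \<open>t\<close>. It depends on
  \<open>m\<close> and \<open>\<delta>\<close> only, so it serves all three models.\<close>
proof (intro exI[of _ "1 / (2 * ln (path_growth m \<delta>))"] conjI allI impI)
  show "0 < 1 / (2 * ln (path_growth m \<delta>))" using path_growth_gt_1[OF assms] by simp
next
  fix c2 :: real and M
  assume c2: "0 < c2 \<and> c2 \<le> 1 / (2 * ln (path_growth m \<delta>))"
  let ?p = "\<lambda>t. measure_pmf.prob (pa_sample M m \<delta> t)
    {(G, A1, A2). ereal_of_enat (graph_dist G A1 A2) \<ge> ereal (c2 * ln (real t))}"
  obtain \<phi> c K \<mu> where chain: "pa_chain m \<delta> \<phi> c K \<mu>"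
    and graph: "\<And>t. 2 \<le> t \<Longrightarrow> pa_graph M m \<delta> t = map_pmf (relabel \<phi>) (\<mu> (m * t))"
    by (rule pa_graph_chain[OF assms, of M]) blast
  show "?p \<longlonglongrightarrow> 1"
  proof (rule tendsto_sandwich)
    show "\<forall>\<^sub>F t in sequentially. 1 - 4 * (c2 * ln (real t) + 1) * real t powr (- 1 / 2) \<le> ?p t"
      using eventually_ge_at_top[of 2]
    proof eventually_elim
      case (elim t)
      then show ?case
        unfolding pa_sample_def graph[OF elim]
        using c2 by (intro pa_chain.prob_far_ge[OF chain]) auto
    qed
    show "\<forall>\<^sub>F t in sequentially. ?p t \<le> 1" by simp
    show "(\<lambda>t. 1 - 4 * (c2 * ln (real t) + 1) * real t powr (- 1 / 2)) \<longlonglongrightarrow> 1"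
      using c2 by real_asymp
  qed simp
qed

end
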